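(* Let $d=2$ and $V$ real-valued. Let $m\in\{1,\dots,Q\}$ and let $\lambda_*$ be an extremum of $\lambda_m$ over $[0,1)^2$ (i.e. $\lambda_*=\max_{k\in[0,1)^2}\lambda_m(k)$ or $\lambda_*=\min_{k\in[0,1)^2}\lambda_m(k)$). Then the set $\{k\in[0,1)^2:\lambda_m(k)=\lambda_*\}$ has cardinality at most $4(q_1+q_2)^2$.
   Context: Fix positive integers $q_1,q_2$ with greatest common divisor $1$, $Q=q_1q_2$, $\Gamma=q_1\mathbb{Z}\oplus q_2\mathbb{Z}$, and a $\Gamma$-periodic $V:\mathbb{Z}^2\to\mathbb{R}$. The discrete Laplacian is $(\Delta u)(n)=\sum_{\|n'-n\|_1=1}u(n')$. For $k\in\mathbb{R}^2$, $D(k)$ is the $Q\times Q$ Hermitian matrix of $-\Delta+V$ acting on the space of $u:\mathbb{Z}^2\to\mathbb{C}$ with $u(n+q_je_j)=e^{2\pi ik_j}u(n)$ ($j=1,2$), identified with functions on $W=\{(n_1,n_2):0\le n_j\le q_j-1\}$. Its eigenvalues in non-decreasing order are $\lambda_1(k)\le\cdots\le\lambda_Q(k)$; $\lambda_m$ is the $m$-th band function. *)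

theory Defs
  imports "Jordan_Normal_Form.Char_Poly" "HOL-Computational_Algebra.Fundamental_Theorem_Algebra"
begin

text \<open>Lattice sites are pairs of integers. The fundamental cell
  W = {(n1,n2). 0 \<le> nj \<le> qj - 1} is enumerated by the index i < q1*q2 via
  i \<mapsto> (i mod q1, i div q1).\<close>

definition cell_site :: "nat \<Rightarrow> nat \<Rightarrow> int \<times> int" where
  "cell_site q1 i = (int (i mod q1), int (i div q1))"

definition cell_index :: "nat \<Rightarrow> int \<times> int \<Rightarrow> nat" where
  "cell_index q1 n = nat (fst n) + q1 * nat (snd n)"

text \<open>Reduction of a site n to W together with the Floquet phase:
  for u with u(n + qj ej) = exp(2 pi i kj) u(n), one has
  u(n) = exp(2 pi i (a1 k1 + a2 k2)) u(n mod (q1,q2)), aj = nj div qj.\<close>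

definition reduce_site :: "nat \<Rightarrow> nat \<Rightarrow> int \<times> int \<Rightarrow> int \<times> int" where
  "reduce_site q1 q2 n = (fst n mod int q1, snd n mod int q2)"

definition floquet_phase :: "nat \<Rightarrow> nat \<Rightarrow> real \<times> real \<Rightarrow> int \<times> int \<Rightarrow> complex" where
  "floquet_phase q1 q2 k n =
     cis (2 * pi * (of_int (fst n div int q1) * fst k + of_int (snd n div int q2) * snd k))"

definition nbrs :: "int \<times> int \<Rightarrow> (int \<times> int) list" where
  "nbrs n = [(fst n + 1, snd n), (fst n - 1, snd n), (fst n, snd n + 1), (fst n, snd n - 1)]"

text \<open>D(k): the matrix of -\<Delta> + V on the Floquet-Bloch space, where
  (\<Delta> u)(n) = sum of u(n') over the four nearest neighbours n'.\<close>

definition floquet_matrix ::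
  "nat \<Rightarrow> nat \<Rightarrow> (int \<times> int \<Rightarrow> real) \<Rightarrow> real \<times> real \<Rightarrow> complex mat" where
  "floquet_matrix q1 q2 V k = mat (q1 * q2) (q1 * q2) (\<lambda>(i, j).
     (if i = j then complex_of_real (V (cell_site q1 i)) else 0)
     - (\<Sum>n'\<leftarrow>nbrs (cell_site q1 i).
          if cell_index q1 (reduce_site q1 q2 n') = j then floquet_phase q1 q2 k n' else 0))"

text \<open>Eigenvalues of D(k), counted with algebraic multiplicity (roots of the
  characteristic polynomial), real since D(k) is Hermitian, in non-decreasing order.\<close>

definition eigenvalues_sorted :: "complex mat \<Rightarrow> real list" where
  "eigenvalues_sorted A = sorted_list_of_multiset (image_mset Re (proots (char_poly A)))"

definition band_function ::
  "nat \<Rightarrow> nat \<Rightarrow> (int \<times> int \<Rightarrow> real) \<Rightarrow> nat \<Rightarrow> real \<times> real \<Rightarrow> real" where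
  "band_function q1 q2 V m k = eigenvalues_sorted (floquet_matrix q1 q2 V k) ! (m - 1)"

definition brillouin_zone :: "(real \<times> real) set" where
  "brillouin_zone = {k. 0 \<le> fst k \<and> fst k < 1 \<and> 0 \<le> snd k \<and> snd k < 1}"

end

theory Submission
  imports Defs "Subresultants.Subresultant_Gcd" "HOL-Computational_Algebra.Field_as_Ring"
begin

text \<open>
  Put \<open>z\<^sub>j = exp (2 \<pi> i k\<^sub>j)\<close>. Up to a monomial, \<open>det (\<lambda>\<^sub>* - D(k))\<close> is a polynomial \<open>f(z\<^sub>1, z\<^sub>2)\<close> of degree at most
  \<open>2 q\<^sub>2\<close> in \<open>z\<^sub>1\<close> and \<open>2 q\<^sub>1\<close> in \<open>z\<^sub>2\<close>. Since the band functions are Lipschitz (Weyl) and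
  \<open>det (\<lambda>\<^sub>* - D(k))\<close> is the product of the \<open>\<lambda>\<^sub>* - \<lambda>\<^sub>j(k)\<close>, every point of the extremal level set of \<open>\<lambda>\<^sub>m\<close> is a common
  zero of \<open>f\<close> and \<open>\<partial>f/\<partial>z\<^sub>2\<close>. The number of common zeros on the torus is bounded by the degree of the
  resultant in \<open>z\<^sub>1\<close>, provided that the resultant does not vanish identically.

  For the latter, substitute \<open>z\<^sub>1 = x ^ q\<^sub>1\<close>, \<open>z\<^sub>2 = y ^ q\<^sub>2\<close>. After a gauge transformation \<open>\<lambda>\<^sub>* - D\<close> becomes
  \<open>x S\<^sub>1 + S\<^sub>1\<inverse> / x + y S\<^sub>2 + S\<^sub>2\<inverse> / y\<close> plus a diagonal matrix, with commuting shifts \<open>S\<^sub>1, S\<^sub>2\<close>. As \<open>q\<^sub>1, q\<^sub>2\<close> are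
  coprime, \<open>S\<^sub>2\<inverse> S\<^sub>1\<close> is a single cycle, so the leading part of the determinant is \<open>\<plusminus> x ^ Q \<plusminus> y ^ Q\<close>
  if \<open>|x|, |y| \<ge> 1\<close>, and likewise with \<open>1 / y\<close> if \<open>|y| \<le> 1\<close>. Hence \<open>f(z\<^sub>1, \<cdot>)\<close> has no multiple root
  \<open>z\<^sub>2 \<noteq> 0\<close> once \<open>|z\<^sub>1|\<close> is large.
\<close>

section \<open>Double roots of bivariate polynomials\<close>

text \<open>Only k2 is moved: with z1 fixed on the unit circle, an extremum over both variables is
  one along the line, and this already gives the equation for the z2-derivative. Four obstacles
  shape the argument. A band need not be differentiable where it meets another, so the derivative is
  taken of the product over all bands, which is smooth, and the bands only need to be Lipschitz.
  Several zeros may share the same z1 and would then give a single root of the resultant; the count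
  therefore needs that root to have order at least the number of zeros above it. The value z2 = 0
  may be a multiple root for every z1, so the power of z2 dividing \<open>f\<close> is removed
  before the resultant is formed. Finally \<open>f\<close> must not vanish on a whole fibre over the
  circle, which the same asymptotics exclude. The degrees 2 q2 and 2 q1 come from multiplying only
  those rows that belong to boundary sites of the cell. They give a resultant of degree at most 2 q2
  (2 q1 + 2 q1) = 8 q1 q2, which is at most 4 (q1 + q2)^2.\<close>

lemma power_card_dvd_det:
  fixes M :: "'a :: comm_ring_1 mat"
  assumes M: "M \<in> carrier_mat n n" and C: "C \<subseteq> {0..<n}"
    and dvd: "\<And>i j. i < n \<Longrightarrow> j \<in> C \<Longrightarrow> d dvd M $$ (i, j)"
  shows "d ^ card C dvd det M"
  unfolding det_def'[OF M]
proof (rule dvd_sum)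
  fix p assume "p \<in> {p. p permutes {0..<n}}"
  hence p: "p permutes {0..<n}" by simp
  \<comment> \<open>The Leibniz term of \<open>p\<close> meets the columns in \<open>C\<close>
    exactly in these rows, so it contains \<open>card C\<close> factors divisible by
    \<open>d\<close>.\<close>
  let ?I = "inv_into UNIV p ` C"
  have I: "?I \<subseteq> {0..<n}" using permutes_in_image[OF permutes_inv[OF p]] C by auto
  have cI: "card ?I = card C" by (rule card_image[OF permutes_inj_on[OF permutes_inv[OF p]]])
  have "(\<Prod>i\<in>?I. d) dvd (\<Prod>i\<in>?I. M $$ (i, p i))"
    by (rule prod_dvd_prod) (use I C permutes_inverses[OF p] dvd in auto)
  hence "d ^ card C dvd (\<Prod>i\<in>?I. M $$ (i, p i))" by (simp add: cI)
  also have "\<dots> dvd (\<Prod>i = 0..<n. M $$ (i, p i))"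
    by (rule prod_dvd_prod_subset) (use I in auto)
  finally show "d ^ card C dvd signof p * (\<Prod>i = 0..<n. M $$ (i, p i))" by simp
qed

text \<open>In \<open>complex poly poly\<close> the outer variable stands for z2 and the
  coefficients are polynomials in z1. Hence \<open>poly_at a\<close> specialises z1, and a resultant
  eliminates z2.\<close>

definition poly_at :: "complex \<Rightarrow> complex poly poly \<Rightarrow> complex poly" where
  "poly_at a f = map_poly (\<lambda>c. poly c a) f"

lemma coeff_poly_at: "coeff (poly_at a f) i = poly (coeff f i) a"
  by (simp add: poly_at_def coeff_map_poly)

interpretation poly_at_hom: comm_ring_hom "poly_at a"
proof -
  interpret c: comm_ring_hom "\<lambda>c. poly c a" by unfold_locales auto
  interpret m: map_poly_comm_ring_hom "\<lambda>c. poly c a" ..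
  show "comm_ring_hom (poly_at a)"
    using m.comm_ring_hom_axioms unfolding poly_at_def .
qed

lemma degree_poly_at_le: "degree (poly_at a f) \<le> degree f"
  unfolding poly_at_def by (rule degree_map_poly_le)

lemma pderiv_poly_at: "pderiv (poly_at a f) = poly_at a (pderiv f)"
  by (rule poly_eqI) (simp add: coeff_pderiv coeff_poly_at)

text \<open>A vector in the left kernel is the coefficient list of a polynomial of degree at most
  \<open>n\<close> that vanishes at the \<open>n\<close> nodes and, having no constant term, also at
  0. The exponents run from \<open>n\<close> to 1 to fit the column numbering of the Sylvester
  matrix; each column is thus a usual Vandermonde column times its node.\<close>

lemma vandermonde_det_nonzero:
  fixes w :: "nat \<Rightarrow> 'a :: idom"
  assumes inj: "inj_on w {0..<n}" and nz: "\<And>c. c < n \<Longrightarrow> w c \<noteq> 0"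
  shows "det (mat n n (\<lambda>(j, c). w c ^ (n - j))) \<noteq> 0"
proof
  let ?W = "mat n n (\<lambda>(j, c). w c ^ (n - j))"
  assume "det ?W = 0"
  hence "det (transpose_mat ?W) = 0" by (subst det_transpose[of _ n]) auto
  then obtain v where v: "v \<in> carrier_vec n" "v \<noteq> 0\<^sub>v n" "transpose_mat ?W *\<^sub>v v = 0\<^sub>v n"
    using det_0_iff_vec_prod_zero[of "transpose_mat ?W" n] by auto
  define q where "q = (\<Sum>j = 0..<n. monom (v $ j) (n - j))"
  have coeff: "coeff q (n - j) = v $ j" if "j < n" for j
  proof -
    have "coeff q (n - j) = (\<Sum>i = 0..<n. if i = j then v $ i else 0)"
      unfolding q_def coeff_sum by (rule sum.cong) (use that in auto)
    thus ?thesis using that by simp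
  qed
  have "q \<noteq> 0"
  proof
    assume "q = 0"
    hence "v $ j = 0" if "j < n" for j using coeff[OF that] by simp
    hence "v = 0\<^sub>v n" using v(1) by (intro eq_vecI) auto
    with v(2) show False by simp
  qed
  have deg: "degree q \<le> n" unfolding q_def
    by (rule degree_sum_le) (auto intro: order.trans[OF degree_monom_le])
  have "poly q (w c) = 0" if "c < n" for c
  proof -
    have "(transpose_mat ?W *\<^sub>v v) $ c = 0" using v(3) that by simp
    thus ?thesis using that v(1)
      by (simp add: q_def poly_sum poly_monom scalar_prod_def mult.commute)
  qed
  moreover have "poly q 0 = 0"
    unfolding q_def poly_sum poly_monom by (rule sum.neutral) auto
  ultimately have sub: "insert 0 (w ` {0..<n}) \<subseteq> {x. poly q x = 0}" by auto
  have "Suc n = card (insert 0 (w ` {0..<n}))"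
    using nz by (subst card_insert_disjoint) (auto simp: card_image[OF inj])
  also have "\<dots> \<le> card {x. poly q x = 0}"
    by (rule card_mono[OF poly_roots_finite[OF \<open>q \<noteq> 0\<close>] sub])
  also have "\<dots> \<le> degree q" by (rule card_poly_roots_bound[OF \<open>q \<noteq> 0\<close>])
  finally show False using deg by simp
qed

text \<open>A row of the Sylvester matrix lists the coefficients of \<open>p\<close> or
  \<open>q\<close> times a power of the variable, highest first, so pairing it with powers of
  \<open>w\<close> is evaluation at \<open>w\<close>. The polynomial \<open>r\<close> below carries
  one extra factor of the variable, because the exponents end at 1.\<close>

lemma sylvester_row_vandermonde:
  fixes p q :: "'a :: comm_ring_1 poly"
  defines "m \<equiv> degree p" and "n \<equiv> degree q"
  assumes i: "i < m + n"
  shows "(\<Sum>j = 0..<m + n. sylvester_mat p q $$ (i, j) * w ^ (m + n - j)) =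
    (if i < n then w ^ (n - i) * poly p w else w ^ (m + n - i) * poly q w)"
proof -
  define r where "r = (if i < n then monom 1 (n - i) * p else monom 1 (m + n - i) * q)"
  have deg: "degree r \<le> m + n"
    unfolding r_def m_def n_def
    by (auto intro!: order.trans[OF degree_mult_le] order.trans[OF add_mono[OF degree_monom_le order.refl]])
  have r0: "coeff r 0 = 0" using i unfolding r_def by (auto simp: coeff_monom_mult)
  have "(\<Sum>j = 0..<m + n. sylvester_mat p q $$ (i, j) * w ^ (m + n - j)) =
        (\<Sum>j = 0..<m + n. coeff r (m + n - j) * w ^ (m + n - j))"
    by (rule sum.cong[OF refl], subst sylvester_index_mat2)
       (use i in \<open>auto simp: r_def m_def n_def\<close>)
  also have "\<dots> = (\<Sum>k\<in>{1..m + n}. coeff r k * w ^ k)"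
    by (rule sum.reindex_bij_witness[of _ "\<lambda>k. m + n - k" "\<lambda>j. m + n - j"]) auto
  also have "\<dots> = (\<Sum>k\<le>m + n. coeff r k * w ^ k)"
    by (rule sum.mono_neutral_left) (auto simp: r0 Suc_le_eq intro!: ccontr[of "_ = (0::nat)"])
  also have "\<dots> = poly r w"
    unfolding poly_altdef
    by (rule sum.mono_neutral_right) (use deg in \<open>auto simp: coeff_eq_0\<close>)
  finally show ?thesis by (simp add: r_def poly_monom)
qed

text \<open>Multiplying the Sylvester matrix by a Vandermonde matrix whose nodes include the common
  roots makes one column per common root vanish at \<open>a\<close>.\<close>

lemma power_dvd_resultant_of_common_roots:
  fixes f g :: "complex poly poly"
  assumes S: "finite S" "card S \<le> degree f + degree g"
    and roots: "\<And>b. b \<in> S \<Longrightarrow> b \<noteq> 0 \<and> poly (poly_at a f) b = 0 \<and> poly (poly_at a g) b = 0"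
  shows "[:-a, 1:] ^ card S dvd resultant f g"
proof -
  let ?N = "degree f + degree g"
  \<comment> \<open>The common roots are padded with arbitrary further nonzero nodes up to the size
    of the Sylvester matrix, which keeps the Vandermonde matrix invertible.\<close>
  have "infinite (- insert 0 S)" using S(1) by (simp add: infinite_UNIV_char_0)
  then obtain T where T: "T \<subseteq> - insert 0 S" "finite T" "card T = ?N - card S"
    using infinite_arbitrarily_large by blast
  have cST: "card (S \<union> T) = ?N" using S T by (subst card_Un_disjoint) auto
  obtain w where w: "bij_betw w {0..<?N} (S \<union> T)"
    using ex_bij_betw_nat_finite[of "S \<union> T"] S T cST by auto
  have nz: "w c \<noteq> 0" if "c < ?N" for c
  proof -
    have "w c \<in> S \<union> T" using bij_betwE[OF w] that by simp
    thus ?thesis using roots T(1) by auto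
  qed
  let ?Wc = "mat ?N ?N (\<lambda>(j, c). w c ^ (?N - j))"
  let ?W = "map_mat (\<lambda>x. [:x:]) ?Wc"
  have detW: "det ?W = [:det ?Wc:]" by (rule coeff_lift_hom.hom_det)
  have detWc: "det ?Wc \<noteq> 0"
    by (rule vandermonde_det_nonzero[OF bij_betw_imp_inj_on[OF w] nz])
  define C where "C = {c \<in> {0..<?N}. w c \<in> S}"
  have "w ` C = w ` {0..<?N} \<inter> S" by (auto simp: C_def)
  hence "w ` C = S" using bij_betw_imp_surj_on[OF w] by auto
  moreover have "inj_on w C" using bij_betw_imp_inj_on[OF w] by (rule inj_on_subset) (auto simp: C_def)
  ultimately have cC: "card C = card S" using card_image by metis
  have "[:-a, 1:] ^ card C dvd det (sylvester_mat f g * ?W)"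
  proof (rule power_card_dvd_det[where n = ?N])
    show "sylvester_mat f g * ?W \<in> carrier_mat ?N ?N"
      by (rule mult_carrier_mat[OF sylvester_carrier_mat]) auto
    show "C \<subseteq> {0..<?N}" by (auto simp: C_def)
    fix i c assume i: "i < ?N" and c: "c \<in> C"
    hence cN: "c < ?N" and "w c \<in> S" by (auto simp: C_def)
    have const: "[:w c:] ^ k = [:w c ^ k:]" for k
      by (rule coeff_lift_hom.hom_power[symmetric])
    have "(sylvester_mat f g * ?W) $$ (i, c) =
          (\<Sum>j = 0..<?N. sylvester_mat f g $$ (i, j) * [:w c:] ^ (?N - j))"
      using i cN unfolding const by (auto simp: scalar_prod_def intro!: sum.cong)
    also have "\<dots> = (if i < degree g then [:w c:] ^ (degree g - i) * poly f [:w c:]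
                      else [:w c:] ^ (?N - i) * poly g [:w c:])"
      by (rule sylvester_row_vandermonde[OF i])
    finally have eq: "(sylvester_mat f g * ?W) $$ (i, c) = \<dots>" .
    have swap: "poly (poly h [:b:]) a = poly (poly_at a h) b" for h b
      by (induction h) (auto simp: poly_at_def map_poly_pCons)
    show "[:-a, 1:] dvd (sylvester_mat f g * ?W) $$ (i, c)"
      unfolding eq poly_eq_0_iff_dvd[symmetric] using roots[OF \<open>w c \<in> S\<close>]
      by (auto simp: swap)
  qed
  hence "[:-a, 1:] ^ card S dvd resultant f g * [:det ?Wc:]"
    unfolding cC resultant_def detW[symmetric]
    by (subst (asm) det_mult[OF sylvester_carrier_mat]) auto
  hence "[:-a, 1:] ^ card S dvd Polynomial.smult (det ?Wc) (resultant f g)" by simp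
  thus ?thesis using detWc by (simp add: dvd_smult_iff)
qed

lemma degree_resultant_le:
  fixes f g :: "'a :: comm_ring_1 poly poly"
  assumes "\<And>i. degree (coeff f i) \<le> K" "\<And>i. degree (coeff g i) \<le> K"
  shows "degree (resultant f g) \<le> K * (degree f + degree g)"
  unfolding resultant_def
  by (rule degree_det_le[OF _ sylvester_carrier_mat])
     (subst sylvester_index_mat, use assms in auto)

text \<open>The zeros are counted fibre by fibre: the number of zeros over \<open>a\<close> is at
  most the order of \<open>a\<close> as a root of the resultant, and the orders add up to at most
  its degree. That \<open>poly_at a f\<close> is nonzero makes every fibre finite and no larger than
  \<open>degree f\<close>.\<close>

lemma card_common_zeros_le:
  fixes f g :: "complex poly poly"
  assumes res: "resultant f g \<noteq> 0"
    and deg: "\<And>i. degree (coeff f i) \<le> K" "\<And>i. degree (coeff g i) \<le> K"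
    and A: "\<And>a. a \<in> A \<Longrightarrow> poly_at a f \<noteq> 0"
  defines "Z \<equiv> {(a, b). a \<in> A \<and> b \<noteq> 0 \<and> poly (poly_at a f) b = 0 \<and> poly (poly_at a g) b = 0}"
  shows "finite Z \<and> card Z \<le> K * (degree f + degree g)"
proof -
  let ?R = "resultant f g"
  define S where "S a = {b. b \<noteq> 0 \<and> poly (poly_at a f) b = 0 \<and> poly (poly_at a g) b = 0}" for a
  have finS: "finite (S a)" and ordS: "card (S a) \<le> order a ?R" if "a \<in> A" for a
  proof -
    have sub: "S a \<subseteq> {b. poly (poly_at a f) b = 0}" by (auto simp: S_def)
    show fin: "finite (S a)" by (rule finite_subset[OF sub poly_roots_finite[OF A[OF that]]])
    have "card (S a) \<le> card {b. poly (poly_at a f) b = 0}"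
      by (rule card_mono[OF poly_roots_finite[OF A[OF that]] sub])
    also have "\<dots> \<le> degree (poly_at a f)" by (rule card_poly_roots_bound[OF A[OF that]])
    also have "\<dots> \<le> degree f" by (rule degree_poly_at_le)
    finally have "[:-a, 1:] ^ card (S a) dvd ?R"
      by (intro power_dvd_resultant_of_common_roots fin) (auto simp: S_def)
    thus "card (S a) \<le> order a ?R" using res unfolding order_divides by simp
  qed
  let ?B = "{a. poly ?R a = 0}"
  have finB: "finite ?B" by (rule poly_roots_finite[OF res])
  have Z: "Z = Sigma (A \<inter> ?B) S"
  proof (intro equalityI subsetI; clarsimp)
    fix a b assume "(a, b) \<in> Z"
    hence a: "a \<in> A" and b: "b \<in> S a" by (auto simp: Z_def S_def)
    from b finS[OF a] have "0 < card (S a)" by (auto simp: card_gt_0_iff)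
    with ordS[OF a] have "order a ?R \<noteq> 0" by simp
    thus "a \<in> A \<and> poly ?R a = 0 \<and> b \<in> S a" using a b res by (simp add: order_root)
  qed (auto simp: Z_def S_def)
  have fin: "finite Z" unfolding Z by (intro finite_SigmaI finite_Int disjI2 finB finS) auto
  have "card Z = (\<Sum>a\<in>A \<inter> ?B. card (S a))"
    unfolding Z by (rule card_SigmaI) (use finB finS in auto)
  also have "\<dots> \<le> (\<Sum>a\<in>A \<inter> ?B. order a ?R)" by (rule sum_mono) (use ordS in auto)
  also have "\<dots> \<le> (\<Sum>a\<in>?B. order a ?R)" by (rule sum_mono2) (use finB in auto)
  also have "\<dots> = size (proots ?R)"
    by (simp add: size_multiset_overloaded_eq res)
  also have "\<dots> \<le> degree ?R" by (rule size_proots_le)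
  also have "\<dots> \<le> K * (degree f + degree g)" by (rule degree_resultant_le[OF deg])
  finally show ?thesis using fin by simp
qed

text \<open>A vanishing resultant yields a gcd of positive degree in z2. Where its leading
  coefficient \<open>c\<close> does not vanish, specialisation keeps this degree, so the specialised
  gcd has a root.\<close>

lemma resultant_zero_imp_generic_common_root:
  fixes f g :: "complex poly poly"
  assumes "resultant f g = 0"
  obtains c where "c \<noteq> 0"
    "\<And>a. poly c a \<noteq> 0 \<Longrightarrow> \<exists>b. poly (poly_at a f) b = 0 \<and> poly (poly_at a g) b = 0"
proof -
  let ?h = "gcd f g"
  have dh: "degree ?h \<noteq> 0" using assms resultant_0_gcd by blast
  hence "?h \<noteq> 0" by force
  show ?thesis
  proof (rule that)
    show "lead_coeff ?h \<noteq> 0" using \<open>?h \<noteq> 0\<close> by simp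
    fix a assume a: "poly (lead_coeff ?h) a \<noteq> 0"
    hence "degree (poly_at a ?h) = degree ?h"
      by (intro antisym degree_poly_at_le le_degree) (simp add: coeff_poly_at)
    with dh have "\<not> constant (poly (poly_at a ?h))" by (simp add: constant_degree)
    then obtain b where b: "poly (poly_at a ?h) b = 0"
      using fundamental_theorem_of_algebra by blast
    have "poly_at a ?h dvd poly_at a f" "poly_at a ?h dvd poly_at a g"
      by (auto intro!: poly_at_hom.hom_dvd)
    with b show "\<exists>b. poly (poly_at a f) b = 0 \<and> poly (poly_at a g) b = 0"
      unfolding poly_eq_0_iff_dvd by (meson dvd_trans)
  qed
qed

lemma ex_nonroot_of_large_norm:
  fixes p :: "complex poly"
  assumes "p \<noteq> 0"
  obtains a where "poly p a \<noteq> 0" "norm a \<ge> r"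
proof -
  have "infinite (complex_of_real ` {max r 0..})"
    by (simp add: finite_image_iff infinite_Ici inj_on_def)
  then obtain a where "a \<in> complex_of_real ` {max r 0..}" "poly p a \<noteq> 0"
    using poly_roots_finite[OF assms] by (metis (mono_tags, lifting) finite_subset mem_Collect_eq subsetI)
  thus ?thesis by (intro that) auto
qed

text \<open>The resultant is formed from \<open>g\<close> and \<open>pderiv g\<close>, where
  \<open>f\<close> is a power of z2 times \<open>g\<close> and z2 does not divide \<open>g\<close>.
  For \<open>f\<close> itself it could vanish identically, since \<open>large\<close> says nothing
  about the root 0.\<close>

proposition card_double_roots_le:
  fixes f :: "complex poly poly"
  assumes deg: "degree f \<le> n" "\<And>i. degree (coeff f i) \<le> K"
    and large: "\<And>a b. norm a \<ge> r \<Longrightarrow> b \<noteq> 0 \<Longrightarrow>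
      \<not> (poly (poly_at a f) b = 0 \<and> poly (pderiv (poly_at a f)) b = 0)"
    and A: "\<And>a. a \<in> A \<Longrightarrow> poly_at a f \<noteq> 0"
  defines "Z \<equiv> {(a, b). a \<in> A \<and> b \<noteq> 0 \<and> poly (poly_at a f) b = 0 \<and> poly (pderiv (poly_at a f)) b = 0}"
  shows "finite Z \<and> card Z \<le> K * (2 * n)"
proof (cases "A = {}")
  case True
  thus ?thesis by (simp add: Z_def)
next
  case False
  hence "f \<noteq> 0" using A by fastforce
  then obtain g where fg: "f = [:-0, 1:] ^ order 0 f * g" and g: "\<not> [:-0, 1:] dvd g"
    using order_decomp by blast
  define k where "k = order 0 f"
  have fg: "f = monom 1 k * g" using fg by (simp add: k_def monom_altdef)
  have "g \<noteq> 0" using g by auto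
  have g0: "coeff g 0 \<noteq> 0" using g unfolding poly_eq_0_iff_dvd[symmetric] by (simp add: poly_0_coeff_0)
  have coeff_g: "coeff g i = coeff f (k + i)" for i by (simp add: fg coeff_monom_mult)
  have deg_g: "degree g \<le> n"
    using deg(1) \<open>g \<noteq> 0\<close> by (simp add: fg degree_mult_eq degree_monom_eq)
  have at: "poly_at a f = monom 1 k * poly_at a g" for a
    by (rule poly_eqI) (auto simp: fg coeff_poly_at coeff_monom_mult)
  have iff: "poly (poly_at a f) b = 0 \<and> poly (pderiv (poly_at a f)) b = 0 \<longleftrightarrow>
        poly (poly_at a g) b = 0 \<and> poly (poly_at a (pderiv g)) b = 0" if "b \<noteq> 0" for a b
    using that by (auto simp: at pderiv_mult poly_monom pderiv_poly_at)
  have res: "resultant g (pderiv g) \<noteq> 0"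
  proof
    assume "resultant g (pderiv g) = 0"
    then obtain c where c: "c \<noteq> 0"
      "\<And>a. poly c a \<noteq> 0 \<Longrightarrow> \<exists>b. poly (poly_at a g) b = 0 \<and> poly (poly_at a (pderiv g)) b = 0"
      using resultant_zero_imp_generic_common_root by blast
    \<comment> \<open>Avoiding the roots of \<open>coeff g 0\<close> as well forces the common root
      \<open>b\<close> to be nonzero, so that \<open>large\<close> applies to it.\<close>
    from c(1) g0 have "c * coeff g 0 \<noteq> 0" by simp
    then obtain a where a: "poly (c * coeff g 0) a \<noteq> 0" "norm a \<ge> r"
      by (rule ex_nonroot_of_large_norm)
    then obtain b where b: "poly (poly_at a g) b = 0 \<and> poly (poly_at a (pderiv g)) b = 0"
      using c(2)[of a] by auto
    have "b \<noteq> 0"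
      using a(1) b by (auto simp: poly_0_coeff_0 coeff_poly_at)
    with iff b large[OF a(2)] show False by blast
  qed
  have Z: "Z = {(a, b). a \<in> A \<and> b \<noteq> 0 \<and> poly (poly_at a g) b = 0 \<and> poly (poly_at a (pderiv g)) b = 0}"
    unfolding Z_def using iff by auto
  have "finite Z \<and> card Z \<le> K * (degree g + degree (pderiv g))"
    unfolding Z
  proof (rule card_common_zeros_le[OF res])
    show "degree (coeff g i) \<le> K" for i unfolding coeff_g by (rule deg)
    show "degree (coeff (pderiv g) i) \<le> K" for i
      unfolding coeff_pderiv coeff_g of_nat_poly using deg(2) by (auto intro: order.trans[OF degree_smult_le])
    show "poly_at a g \<noteq> 0" if "a \<in> A" for a using A[OF that] by (auto simp: at)
  qed
  moreover have "degree g + degree (pderiv g) \<le> 2 * n"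
    using deg_g degree_pderiv_le[of g] by linarith
  ultimately show ?thesis by (meson mult_le_mono2 order_trans)
qed

section \<open>Eigenvalues of Hermitian matrices\<close>

definition ctranspose :: "complex mat \<Rightarrow> complex mat" where
  "ctranspose A = mat (dim_col A) (dim_row A) (\<lambda>(i, j). cnj (A $$ (j, i)))"

lemma ctranspose_carrier [simp]: "A \<in> carrier_mat n m \<Longrightarrow> ctranspose A \<in> carrier_mat m n"
  by (auto simp: ctranspose_def)

lemma ctranspose_dim [simp]: "dim_row (ctranspose A) = dim_col A" "dim_col (ctranspose A) = dim_row A"
  by (auto simp: ctranspose_def)

lemma ctranspose_index [simp]:
  "i < dim_col A \<Longrightarrow> j < dim_row A \<Longrightarrow> ctranspose A $$ (i, j) = cnj (A $$ (j, i))"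
  by (auto simp: ctranspose_def)

lemma ctranspose_mult:
  assumes "A \<in> carrier_mat n k" "B \<in> carrier_mat k m"
  shows "ctranspose (A * B) = ctranspose B * ctranspose A"
  by (rule eq_matI) (use assms in \<open>auto simp: scalar_prod_def mult.commute intro!: sum.cong\<close>)

lemma ctranspose_eq_iff:
  assumes "A \<in> carrier_mat n n"
  shows "ctranspose A = A \<longleftrightarrow> (\<forall>i<n. \<forall>j<n. cnj (A $$ (j, i)) = A $$ (i, j))"
proof
  assume h: "ctranspose A = A"
  show "\<forall>i<n. \<forall>j<n. cnj (A $$ (j, i)) = A $$ (i, j)"
  proof (intro allI impI)
    fix i j assume "i < n" "j < n"
    thus "cnj (A $$ (j, i)) = A $$ (i, j)"
      using assms arg_cong[OF h, of "\<lambda>M. M $$ (i, j)"] by auto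
  qed
next
  assume "\<forall>i<n. \<forall>j<n. cnj (A $$ (j, i)) = A $$ (i, j)"
  thus "ctranspose A = A" using assms by (intro eq_matI) auto
qed

definition cinner :: "complex vec \<Rightarrow> complex vec \<Rightarrow> complex" where
  "cinner x y = (\<Sum>i = 0..<dim_vec y. cnj (x $ i) * y $ i)"

lemma cinner_mult_mat_vec:
  assumes "M \<in> carrier_mat n m" "x \<in> carrier_vec n" "y \<in> carrier_vec m"
  shows "cinner x (M *\<^sub>v y) = cinner (ctranspose M *\<^sub>v x) y"
proof -
  have "cinner x (M *\<^sub>v y) = (\<Sum>i = 0..<n. \<Sum>j = 0..<m. cnj (x $ i) * (M $$ (i, j) * y $ j))"
    using assms by (auto simp: cinner_def scalar_prod_def sum_distrib_left intro!: sum.cong)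
  also have "\<dots> = (\<Sum>j = 0..<m. \<Sum>i = 0..<n. cnj (x $ i) * (M $$ (i, j) * y $ j))"
    by (rule sum.swap)
  also have "\<dots> = cinner (ctranspose M *\<^sub>v x) y"
    using assms by (auto simp: cinner_def scalar_prod_def sum_distrib_left mult_ac intro!: sum.cong)
  finally show ?thesis .
qed

lemma cinner_self: "cinner x x = of_real (\<Sum>i = 0..<dim_vec x. (cmod (x $ i))\<^sup>2)"
  unfolding cinner_def of_real_sum by (rule sum.cong) (simp_all only: complex_norm_square mult.commute)

lemma cinner_self_pos:
  assumes "x \<in> carrier_vec n" "x \<noteq> 0\<^sub>v n"
  shows "Re (cinner x x) > 0"
proof -
  from assms obtain k where "k < n" "x $ k \<noteq> 0" by (metis carrier_vecD eq_vecI index_zero_vec)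
  thus ?thesis using assms(1)
    by (auto simp: cinner_self intro!: sum_pos2[of _ k])
qed

definition real_diag :: "nat \<Rightarrow> (nat \<Rightarrow> real) \<Rightarrow> complex mat" where
  "real_diag n b = mat n n (\<lambda>(i, j). if i = j then of_real (b i) else 0)"

lemma real_diag_carrier [simp]: "real_diag n b \<in> carrier_mat n n"
  by (simp add: real_diag_def)

lemma real_diag_mult_vec:
  assumes "c \<in> carrier_vec n" "i < n"
  shows "(real_diag n b *\<^sub>v c) $ i = of_real (b i) * c $ i"
proof -
  have "(real_diag n b *\<^sub>v c) $ i = (\<Sum>j = 0..<n. (if i = j then of_real (b i) else 0) * c $ j)"
    using assms by (simp add: real_diag_def scalar_prod_def)
  also have "\<dots> = (\<Sum>j = 0..<n. if j = i then of_real (b i) * c $ i else 0)"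
    by (rule sum.cong) auto
  finally show ?thesis using assms by simp
qed

text \<open>\<open>H\<close> is the reflection along \<open>u\<close>, the normalised vector
  \<open>s\<close> minus \<alpha> times the first unit vector. The phase \<alpha> is opposite to
  that of \<open>s 0\<close>; this makes the squared norm of \<open>u\<close> equal to
  \<open>2 * c\<close> with \<open>c\<close> = 1 + |s 0|, which never vanishes, and sends the unit
  vector to a multiple of \<open>v\<close>.\<close>

lemma householder:
  fixes v :: "complex vec"
  assumes v: "v \<in> carrier_vec n" "v \<noteq> 0\<^sub>v n" and n: "n > 0"
  obtains H \<beta> where "H \<in> carrier_mat n n" "ctranspose H = H" "H * H = 1\<^sub>m n"
    "\<beta> \<noteq> 0" "H *\<^sub>v unit_vec n 0 = \<beta> \<cdot>\<^sub>v v"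
proof -
  define N where "N = sqrt (Re (cinner v v))"
  have N: "N > 0" using cinner_self_pos[OF v] by (simp add: N_def)
  define s where "s i = v $ i / of_real N" for i
  define \<alpha> where "\<alpha> = (if s 0 = 0 then 1 else - s 0 / of_real (cmod (s 0)))"
  have \<alpha>: "cnj \<alpha> * \<alpha> = 1" "s 0 = - \<alpha> * of_real (cmod (s 0))"
    by (auto simp: \<alpha>_def mult.commute[of "cnj _"] complex_norm_square[symmetric] norm_divide divide_simps
        simp flip: of_real_power power2_eq_square)
  have \<alpha>nz: "\<alpha> \<noteq> 0" using \<alpha>(1) by auto
  define c where "c = complex_of_real (1 + cmod (s 0))"
  have c: "c \<noteq> 0" unfolding c_def of_real_eq_0_iff using norm_ge_zero[of "s 0"] by linarith
  define u where "u i = s i - (if i = 0 then \<alpha> else 0)" for i :: nat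
  have ss: "(\<Sum>i = 0..<n. cnj (s i) * s i) = 1"
  proof -
    have "(\<Sum>i = 0..<n. cnj (s i) * s i) = cinner v v / of_real (N\<^sup>2)"
      using v(1) by (auto simp: s_def cinner_def sum_divide_distrib power2_eq_square intro!: sum.cong)
    also have "cinner v v = of_real (N\<^sup>2)"
      using cinner_self_pos[OF v] by (simp add: N_def cinner_self del: of_real_sum)
    finally show ?thesis using N by simp
  qed
  have s0: "cnj \<alpha> * s 0 = - of_real (cmod (s 0))"
    using \<alpha> by (metis mult.assoc mult_1 mult_minus_left mult_minus_right)
  have s0': "cnj (s 0) * \<alpha> = - of_real (cmod (s 0))"
    using arg_cong[OF s0, of cnj] by (simp add: mult.commute)
  have uu: "(\<Sum>i = 0..<n. cnj (u i) * u i) = 2 * c"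
  proof -
    have "(\<Sum>i = 0..<n. cnj (u i) * u i) =
      (\<Sum>i = 0..<n. cnj (s i) * s i + (if i = 0 then cnj \<alpha> * \<alpha> - cnj \<alpha> * s 0 - cnj (s 0) * \<alpha> else 0))"
      by (rule sum.cong) (auto simp: u_def algebra_simps)
    also have "\<dots> = 2 * c" using n by (simp add: sum.distrib ss \<alpha>(1) s0 s0' c_def)
    finally show ?thesis .
  qed
  define H where "H = mat n n (\<lambda>(i, j). (if i = j then 1 else 0) - u i * cnj (u j) / c)"
  have cc: "cnj c = c" by (simp add: c_def)
  have HH: "H * H = 1\<^sub>m n"
  proof (rule eq_matI)
    fix i j assume "i < dim_row (1\<^sub>m n :: complex mat)" "j < dim_col (1\<^sub>m n :: complex mat)"
    hence i: "i < n" and j: "j < n" by auto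
    have "(H * H) $$ (i, j) = (\<Sum>k = 0..<n. ((if i = k then 1 else 0) - u i * cnj (u k) / c) *
        ((if k = j then 1 else 0) - u k * cnj (u j) / c))"
      using i j by (auto simp: H_def scalar_prod_def)
    also have "\<dots> = (\<Sum>k = 0..<n. (if k = i then (if i = j then 1 else 0) - u i * cnj (u j) / c else 0)
        - (if k = j then u i * cnj (u j) / c else 0)
        + u i * cnj (u j) / c\<^sup>2 * (cnj (u k) * u k))"
      by (rule sum.cong) (auto simp: algebra_simps power2_eq_square)
    also have "\<dots> = (if i = j then 1 else 0) - 2 * (u i * cnj (u j) / c)
        + u i * cnj (u j) / c\<^sup>2 * (2 * c)"
      unfolding sum.distrib sum_subtractf sum_distrib_left[symmetric] uu using i j by simp
    also have "\<dots> = (if i = j then 1 else 0)" using c by (simp add: power2_eq_square)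
    finally show "(H * H) $$ (i, j) = 1\<^sub>m n $$ (i, j)" using i j by simp
  qed (auto simp: H_def)
  have "- cnj (u 0) = cnj \<alpha> * c"
    using arg_cong[OF \<alpha>(2), of cnj] by (simp add: u_def c_def algebra_simps)
  hence "cnj (u 0) = - cnj \<alpha> * c" by (metis minus_minus mult_minus_left)
  hence u0: "cnj (u 0) / c = - cnj \<alpha>" using c by simp
  have "H *\<^sub>v unit_vec n 0 = (cnj \<alpha> / of_real N) \<cdot>\<^sub>v v"
  proof (rule eq_vecI)
    fix i assume "i < dim_vec ((cnj \<alpha> / of_real N) \<cdot>\<^sub>v v)"
    hence i: "i < n" using v(1) by simp
    have "(H *\<^sub>v unit_vec n 0) $ i = H $$ (i, 0)" using i n by (simp add: H_def)
    also have "\<dots> = (if i = 0 then 1 else 0) - u i * (cnj (u 0) / c)" using i n by (simp add: H_def)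
    also have "\<dots> = cnj \<alpha> * s i" unfolding u0 using \<alpha>(1) by (auto simp: u_def algebra_simps)
    finally show "(H *\<^sub>v unit_vec n 0) $ i = ((cnj \<alpha> / of_real N) \<cdot>\<^sub>v v) $ i"
      using i v(1) by (simp add: s_def)
  qed (use v(1) in \<open>auto simp: H_def\<close>)
  moreover have "ctranspose H = H"
    by (rule eq_matI) (auto simp: H_def cc)
  ultimately show ?thesis
    using that[of H "cnj \<alpha> / of_real N"] HH \<alpha>nz N by (auto simp: H_def)
qed

text \<open>Deflation: conjugating by a reflection that carries the first unit vector to an
  eigenvector leaves a Hermitian matrix whose first column is a multiple of that unit vector. By
  symmetry the first row has the same form, and the remaining block is smaller.\<close>

theorem hermitian_diagonalization:
  assumes "A \<in> carrier_mat n n" "ctranspose A = A"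
  shows "\<exists>U b. U \<in> carrier_mat n n \<and> ctranspose U * U = 1\<^sub>m n \<and> A * U = U * real_diag n b"
  using assms
proof (induction n arbitrary: A)
  case 0
  show ?case by (rule exI[of _ "1\<^sub>m 0"]) (use 0 in \<open>auto simp: real_diag_def intro!: eq_matI\<close>)
next
  case (Suc n A)
  note A = Suc.prems(1) and AH = Suc.prems(2)
  have "degree (char_poly A) = Suc n" using degree_monic_char_poly[OF A] by simp
  hence "\<not> constant (poly (char_poly A))" by (simp add: constant_degree)
  then obtain e where "poly (char_poly A) e = 0" using fundamental_theorem_of_algebra by blast
  then obtain v where v: "v \<in> carrier_vec (Suc n)" "v \<noteq> 0\<^sub>v (Suc n)" "A *\<^sub>v v = e \<cdot>\<^sub>v v"
    using eigenvalue_root_char_poly[OF A] A unfolding eigenvalue_def eigenvector_def by auto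
  obtain H \<beta> where H: "H \<in> carrier_mat (Suc n) (Suc n)" "ctranspose H = H" "H * H = 1\<^sub>m (Suc n)"
    and \<beta>: "\<beta> \<noteq> 0" and He: "H *\<^sub>v unit_vec (Suc n) 0 = \<beta> \<cdot>\<^sub>v v"
    using householder[OF v(1,2)] by blast
  let ?e = "unit_vec (Suc n) 0 :: complex vec"
  define B where "B = H * (A * H)"
  have B: "B \<in> carrier_mat (Suc n) (Suc n)" using A H by (simp add: B_def)
  have BH: "ctranspose B = B"
    unfolding B_def using A H AH
    by (simp add: ctranspose_mult[of _ "Suc n" "Suc n" _ "Suc n"] assoc_mult_mat[of _ "Suc n" "Suc n" _ "Suc n" _ "Suc n"])
  have "B *\<^sub>v ?e = H *\<^sub>v (A *\<^sub>v (H *\<^sub>v ?e))"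
    unfolding B_def using A H by (simp add: assoc_mult_mat_vec[of _ "Suc n" "Suc n" _ "Suc n"])
  also have "\<dots> = H *\<^sub>v (e \<cdot>\<^sub>v (\<beta> \<cdot>\<^sub>v v))"
    unfolding He using A v by (simp add: mult_mat_vec[of _ "Suc n" "Suc n"] smult_smult_assoc mult.commute)
  also have "\<dots> = e \<cdot>\<^sub>v (H *\<^sub>v (H *\<^sub>v ?e))"
    unfolding He using H v by (simp add: mult_mat_vec[of _ "Suc n" "Suc n"])
  also have "H *\<^sub>v (H *\<^sub>v ?e) = ?e"
    using H by (simp flip: assoc_mult_mat_vec[of _ "Suc n" "Suc n" _ "Suc n"])
  finally have Be: "B *\<^sub>v ?e = e \<cdot>\<^sub>v ?e" .
  have col0: "B $$ (i, 0) = (if i = 0 then e else 0)" if "i < Suc n" for i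
    using arg_cong[OF Be, of "\<lambda>x. x $ i"] that B by auto
  have sym: "cnj (B $$ (j, i)) = B $$ (i, j)" if "i < Suc n" "j < Suc n" for i j
    using BH that ctranspose_eq_iff[OF B] by blast
  have row0: "B $$ (0, j) = (if j = 0 then e else 0)" if "j < Suc n" for j
    using sym[of 0 j] col0[of j] col0[of 0] that by auto
  have "cnj e = e" using sym[of 0 0] col0[of 0] by simp
  hence e: "e = of_real (Re e)" by (simp add: complex_eq_iff)
  define C where "C = mat n n (\<lambda>(i, j). B $$ (Suc i, Suc j))"
  have C: "C \<in> carrier_mat n n" by (simp add: C_def)
  have "ctranspose C = C" unfolding ctranspose_eq_iff[OF C] using sym by (auto simp: C_def)
  from Suc.IH[OF C this] obtain W b where W: "W \<in> carrier_mat n n" "ctranspose W * W = 1\<^sub>m n"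
    "C * W = W * real_diag n b" by blast
  \<comment> \<open>\<open>X\<close> is the block sum of 1 and \<open>W\<close>, and
    \<open>d\<close> puts the split-off eigenvalue in front of \<open>b\<close>.\<close>
  define X where "X = mat (Suc n) (Suc n) (\<lambda>(i, j). if i = 0 \<or> j = 0 then (if i = j then 1 else 0) else W $$ (i - 1, j - 1))"
  define d where "d = (\<lambda>i. case i of 0 \<Rightarrow> Re e | Suc i \<Rightarrow> b i)"
  have X: "X \<in> carrier_mat (Suc n) (Suc n)" by (simp add: X_def)
  have Xs: "X $$ (0, 0) = 1" "X $$ (0, Suc j) = 0" "X $$ (Suc i, 0) = 0" "X $$ (Suc i, Suc j) = W $$ (i, j)"
    if "i < n" "j < n" for i j using that by (auto simp: X_def)
  have X00: "X $$ (0, 0) = 1" by (simp add: X_def)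
  have XX: "ctranspose X * X = 1\<^sub>m (Suc n)"
  proof (rule eq_matI)
    fix i j assume "i < dim_row (1\<^sub>m (Suc n) :: complex mat)" "j < dim_col (1\<^sub>m (Suc n) :: complex mat)"
    hence ij: "i < Suc n" "j < Suc n" by auto
    have "(ctranspose X * X) $$ (i, j) = (\<Sum>k = 0..<Suc n. cnj (X $$ (k, i)) * X $$ (k, j))"
      using ij X by (auto simp: scalar_prod_def)
    also have "\<dots> = cnj (X $$ (0, i)) * X $$ (0, j) + (\<Sum>k = 0..<n. cnj (X $$ (Suc k, i)) * X $$ (Suc k, j))"
      by (rule sum.atLeast0_lessThan_Suc_shift[unfolded comp_def])
    also have "\<dots> = 1\<^sub>m (Suc n) $$ (i, j)"
    proof (cases i)
      case 0
      thus ?thesis using ij by (cases j) (auto simp: Xs X00)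
    next
      case (Suc i')
      show ?thesis
      proof (cases j)
        case 0
        thus ?thesis using ij Suc by (auto simp: Xs)
      next
        case (Suc j')
        have "(ctranspose W * W) $$ (i', j') = (\<Sum>k = 0..<n. cnj (W $$ (k, i')) * W $$ (k, j'))"
          using ij W(1) \<open>i = Suc i'\<close> Suc by (auto simp: scalar_prod_def)
        thus ?thesis using W(2) ij Suc \<open>i = Suc i'\<close> by (auto simp: Xs)
      qed
    qed
    finally show "(ctranspose X * X) $$ (i, j) = 1\<^sub>m (Suc n) $$ (i, j)" .
  qed (use X in auto)
  have diag_right: "(M * real_diag k f) $$ (i, j) = M $$ (i, j) * of_real (f j)"
    if "M \<in> carrier_mat k k" "i < k" "j < k" for M k f i j
  proof -
    have "(M * real_diag k f) $$ (i, j) = (\<Sum>l = 0..<k. M $$ (i, l) * (if l = j then of_real (f l) else 0))"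
      using that by (simp add: scalar_prod_def real_diag_def)
    also have "\<dots> = (\<Sum>l = 0..<k. if l = j then M $$ (i, j) * of_real (f j) else 0)"
      by (rule sum.cong) auto
    finally show ?thesis using that by simp
  qed
  have BX: "B * X = X * real_diag (Suc n) d"
  proof (rule eq_matI)
    fix i j assume "i < dim_row (X * real_diag (Suc n) d)" "j < dim_col (X * real_diag (Suc n) d)"
    hence ij: "i < Suc n" "j < Suc n" using X by (auto simp: real_diag_def)
    have "(B * X) $$ (i, j) = (\<Sum>k = 0..<Suc n. B $$ (i, k) * X $$ (k, j))"
      using ij X B by (auto simp: scalar_prod_def)
    also have "\<dots> = B $$ (i, 0) * X $$ (0, j) + (\<Sum>k = 0..<n. B $$ (i, Suc k) * X $$ (Suc k, j))"
      by (rule sum.atLeast0_lessThan_Suc_shift[unfolded comp_def])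
    also have "\<dots> = X $$ (i, j) * of_real (d j)"
    proof (cases j)
      case 0
      thus ?thesis using ij e by (cases i) (auto simp: Xs X00 col0 d_def)
    next
      case (Suc j')
      show ?thesis
      proof (cases i)
        case 0
        thus ?thesis using ij Suc by (auto simp: Xs row0)
      next
        case (Suc i')
        have "(C * W) $$ (i', j') = (\<Sum>k = 0..<n. B $$ (i, Suc k) * X $$ (Suc k, j))"
          using ij W(1) \<open>j = Suc j'\<close> Suc by (auto simp: scalar_prod_def C_def Xs)
        moreover have "(C * W) $$ (i', j') = W $$ (i', j') * of_real (b j')"
          unfolding W(3) using ij Suc \<open>j = Suc j'\<close> W(1) by (intro diag_right) auto
        ultimately show ?thesis using ij Suc \<open>j = Suc j'\<close> by (auto simp: Xs d_def)
      qed
    qed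
    also have "\<dots> = (X * real_diag (Suc n) d) $$ (i, j)" using diag_right[OF X ij] by simp
    finally show "(B * X) $$ (i, j) = (X * real_diag (Suc n) d) $$ (i, j)" .
  qed (use X B in \<open>auto simp: real_diag_def\<close>)
  note assoc = assoc_mult_mat[of _ "Suc n" "Suc n" _ "Suc n" _ "Suc n"]
  show ?case
  proof (intro exI[of _ "H * X"] exI[of _ d] conjI)
    show "H * X \<in> carrier_mat (Suc n) (Suc n)" using H X by simp
    have "ctranspose (H * X) * (H * X) = ctranspose X * (H * (H * X))"
      using H X by (simp add: ctranspose_mult[of _ "Suc n" "Suc n" _ "Suc n"] assoc)
    also have "H * (H * X) = (H * H) * X" by (rule assoc_mult_mat[OF H(1) H(1) X, symmetric])
    also have "\<dots> = X" using H(3) X by simp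
    finally show "ctranspose (H * X) * (H * X) = 1\<^sub>m (Suc n)" using XX by simp
    have "A * (H * X) = (H * H) * (A * (H * X))" using H A X by simp
    also have "\<dots> = H * (H * (A * (H * X)))" using H A X by (intro assoc_mult_mat[OF H(1) H(1), of _ "Suc n"]) simp
    also have "H * (A * (H * X)) = B * X" unfolding B_def using H(1) A X by (simp add: assoc)
    also have "H * (B * X) = (H * X) * real_diag (Suc n) d" unfolding BX using H X by (simp add: assoc)
    finally show "A * (H * X) = (H * X) * real_diag (Suc n) d" .
  qed
qed

section \<open>Quadratic forms in an eigenbasis and Weyl's inequality\<close>

lemma cinner_real_diag:
  assumes "c \<in> carrier_vec n"
  shows "cinner c (real_diag n b *\<^sub>v c) = of_real (\<Sum>j = 0..<n. b j * (cmod (c $ j))\<^sup>2)"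
proof -
  have "cinner c (real_diag n b *\<^sub>v c) = (\<Sum>j = 0..<n. cnj (c $ j) * (of_real (b j) * c $ j))"
    unfolding cinner_def using assms real_diag_carrier[of n b]
    by (intro sum.cong) (simp_all add: real_diag_mult_vec del: index_mult_mat_vec real_diag_carrier)
  also have "\<dots> = (\<Sum>j = 0..<n. of_real (b j * (cmod (c $ j))\<^sup>2))"
    by (rule sum.cong) (simp_all add: complex_norm_square algebra_simps del: of_real_power)
  finally show ?thesis by simp
qed

lemma cinner_diagonalized:
  assumes A: "A \<in> carrier_mat n n" and U: "U \<in> carrier_mat n n" "ctranspose U * U = 1\<^sub>m n"
    and AU: "A * U = U * real_diag n b" and c: "c \<in> carrier_vec n"
  shows "cinner (U *\<^sub>v c) (A *\<^sub>v (U *\<^sub>v c)) = of_real (\<Sum>j = 0..<n. b j * (cmod (c $ j))\<^sup>2)"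
    and "cinner (U *\<^sub>v c) (U *\<^sub>v c) = of_real (\<Sum>j = 0..<n. (cmod (c $ j))\<^sup>2)"
proof -
  have Dc: "real_diag n b *\<^sub>v c \<in> carrier_vec n"
    by (rule mult_mat_vec_carrier[OF real_diag_carrier c])
  have Uc: "U *\<^sub>v c \<in> carrier_vec n" by (rule mult_mat_vec_carrier[OF U(1) c])
  have UUc: "ctranspose U *\<^sub>v (U *\<^sub>v c) = c"
    using U c by (simp flip: assoc_mult_mat_vec[of _ n n _ n])
  have "A *\<^sub>v (U *\<^sub>v c) = U *\<^sub>v (real_diag n b *\<^sub>v c)"
    using A U c by (simp add: AU flip: assoc_mult_mat_vec[of _ n n _ n])
  hence "cinner (U *\<^sub>v c) (A *\<^sub>v (U *\<^sub>v c)) = cinner c (real_diag n b *\<^sub>v c)"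
    using cinner_mult_mat_vec[OF U(1) Uc Dc] UUc by simp
  thus "cinner (U *\<^sub>v c) (A *\<^sub>v (U *\<^sub>v c)) = of_real (\<Sum>j = 0..<n. b j * (cmod (c $ j))\<^sup>2)"
    using cinner_real_diag[OF c] by simp
  show "cinner (U *\<^sub>v c) (U *\<^sub>v c) = of_real (\<Sum>j = 0..<n. (cmod (c $ j))\<^sup>2)"
    using cinner_mult_mat_vec[OF U(1) Uc c] UUc cinner_self[of c] c by simp
qed

text \<open>Fewer linear conditions \<open>I\<close> than free coordinates \<open>J\<close>: the conditions are placed in rows of a
  square matrix that keeps a zero row, so its determinant vanishes.\<close>

lemma ex_kernel_vector_supported_on:
  fixes M :: "'a :: idom mat"
  assumes I: "I \<subseteq> {0..<n}" and J: "J \<subseteq> {0..<n}" and IJ: "card I < card J"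
  obtains c where "c \<in> carrier_vec n" "c \<noteq> 0\<^sub>v n" "\<And>j. j < n \<Longrightarrow> j \<notin> J \<Longrightarrow> c $ j = 0"
    "\<And>i. i \<in> I \<Longrightarrow> (\<Sum>j = 0..<n. M $$ (i, j) * c $ j) = 0"
proof -
  have fin: "finite I" "finite J" using I J by (auto intro: finite_subset)
  obtain \<phi> where \<phi>: "inj_on \<phi> I" "\<phi> ` I \<subseteq> J"
    using card_le_inj[OF fin] IJ by auto
  have "card (\<phi> ` I) < card J" using IJ card_image[OF \<phi>(1)] by simp
  then obtain k where k: "k \<in> J" "k \<notin> \<phi> ` I"
    using \<phi>(2) fin by (metis card_mono finite_imageI leD subsetI)
  \<comment> \<open>Rows outside \<open>J\<close> are identity rows and force the support condition,
    rows in the image of \<phi> carry the conditions from \<open>I\<close>, and row \<open>k\<close>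
    is zero.\<close>
  define K where "K = mat n n (\<lambda>(r, j). if r \<notin> J then (if r = j then 1 else 0)
      else if r \<in> \<phi> ` I then M $$ (inv_into I \<phi> r, j) else 0)"
  have K: "K \<in> carrier_mat n n" by (simp add: K_def)
  have "det K = 0" unfolding det_def'[OF K]
  proof (rule sum.neutral, safe)
    fix p assume p: "p permutes {0..<n}"
    have "k < n" "p k < n" using k J permutes_in_image[OF p, of k] by auto
    hence "K $$ (k, p k) = 0" using k by (simp add: K_def)
    hence "(\<Prod>i = 0..<n. K $$ (i, p i)) = 0" using \<open>k < n\<close> by (intro prod_zero) auto
    thus "signof p * (\<Prod>i = 0..<n. K $$ (i, p i)) = 0" by simp
  qed
  then obtain c where c: "c \<in> carrier_vec n" "c \<noteq> 0\<^sub>v n" "K *\<^sub>v c = 0\<^sub>v n"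
    using det_0_iff_vec_prod_zero[OF K] by blast
  have row: "(\<Sum>j = 0..<n. K $$ (r, j) * c $ j) = 0" if "r < n" for r
    using arg_cong[OF c(3), of "\<lambda>x. x $ r"] that K c(1) by (auto simp: scalar_prod_def)
  show ?thesis
  proof (rule that[OF c(1,2)])
    fix j assume j: "j < n" "j \<notin> J"
    have "(\<Sum>l = 0..<n. K $$ (j, l) * c $ l) = (\<Sum>l = 0..<n. if l = j then c $ j else 0)"
      by (rule sum.cong) (use j in \<open>auto simp: K_def\<close>)
    thus "c $ j = 0" using row[OF j(1)] j by simp
  next
    fix i assume i: "i \<in> I"
    hence \<phi>i: "\<phi> i \<in> J" using \<phi> by auto
    hence \<phi>n: "\<phi> i < n" using J by auto
    have "(\<Sum>l = 0..<n. K $$ (\<phi> i, l) * c $ l) = (\<Sum>l = 0..<n. M $$ (i, l) * c $ l)"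
      by (rule sum.cong) (use \<phi>i \<phi>n i \<phi> in \<open>auto simp: K_def\<close>)
    thus "(\<Sum>j = 0..<n. M $$ (i, j) * c $ j) = 0" using row[OF \<phi>n] by simp
  qed
qed

lemma weyl_count:
  assumes A: "A \<in> carrier_mat n n" and U: "U \<in> carrier_mat n n" "ctranspose U * U = 1\<^sub>m n"
    and AU: "A * U = U * real_diag n a"
    and B: "B \<in> carrier_mat n n" and W: "W \<in> carrier_mat n n" "ctranspose W * W = 1\<^sub>m n"
    and BW: "B * W = W * real_diag n b"
    and le: "\<And>x. x \<in> carrier_vec n \<Longrightarrow>
      Re (cinner x (B *\<^sub>v x)) \<le> Re (cinner x (A *\<^sub>v x)) + \<epsilon> * Re (cinner x x)"
  shows "card {j \<in> {0..<n}. a j \<le> t} \<le> card {j \<in> {0..<n}. b j \<le> t + \<epsilon>}"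
proof (rule ccontr)
  let ?J = "{j \<in> {0..<n}. a j \<le> t}" and ?I = "{j \<in> {0..<n}. b j \<le> t + \<epsilon>}"
  \<comment> \<open>Change of coordinates from the eigenbasis of \<open>A\<close> to that of
    \<open>B\<close>.\<close>
  let ?M = "ctranspose W * U"
  assume "\<not> card ?J \<le> card ?I"
  hence "card ?I < card ?J" by simp
  then obtain c where c: "c \<in> carrier_vec n" "c \<noteq> 0\<^sub>v n" "\<And>j. j < n \<Longrightarrow> j \<notin> ?J \<Longrightarrow> c $ j = 0"
    "\<And>i. i \<in> ?I \<Longrightarrow> (\<Sum>j = 0..<n. ?M $$ (i, j) * c $ j) = 0"
    by (rule ex_kernel_vector_supported_on[of ?I n ?J, rotated 2]) auto
  define x where "x = U *\<^sub>v c"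
  define d where "d = ?M *\<^sub>v c"
  have x: "x \<in> carrier_vec n" unfolding x_def by (rule mult_mat_vec_carrier[OF U(1) c(1)])
  have d: "d \<in> carrier_vec n" unfolding d_def
    by (rule mult_mat_vec_carrier[OF mult_carrier_mat[OF ctranspose_carrier[OF W(1)] U(1)] c(1)])
  have WW: "W * ctranspose W = 1\<^sub>m n"
    using mat_mult_left_right_inverse[of "ctranspose W" n W] W by simp
  have "W *\<^sub>v d = (W * ctranspose W) *\<^sub>v x"
    unfolding d_def x_def using W U c(1) by (simp add: assoc_mult_mat_vec[of _ n n _ n] del: WW)
  hence xd: "x = W *\<^sub>v d" using WW x by simp
  have d0: "d $ i = 0" if "i \<in> ?I" for i
    using c(4)[OF that] that W U c(1) by (auto simp: d_def scalar_prod_def)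
  have na: "Re (cinner x x) = (\<Sum>j = 0..<n. (cmod (c $ j))\<^sup>2)"
    unfolding x_def using cinner_diagonalized(2)[OF A U AU c(1)] by simp
  have nb: "Re (cinner x x) = (\<Sum>j = 0..<n. (cmod (d $ j))\<^sup>2)"
    unfolding xd using cinner_diagonalized(2)[OF B W BW d] by simp
  have pos: "Re (cinner x x) > 0"
    unfolding na using cinner_self_pos[OF c(1,2)] c(1) by (simp add: cinner_self)
  have "Re (cinner x (A *\<^sub>v x)) = (\<Sum>j = 0..<n. a j * (cmod (c $ j))\<^sup>2)"
    unfolding x_def using cinner_diagonalized(1)[OF A U AU c(1)] by simp
  also have "\<dots> \<le> (\<Sum>j = 0..<n. t * (cmod (c $ j))\<^sup>2)"
  proof (rule sum_mono)
    fix j assume "j \<in> {0..<n}"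
    thus "a j * (cmod (c $ j))\<^sup>2 \<le> t * (cmod (c $ j))\<^sup>2"
      using c(3)[of j] by (cases "j \<in> ?J") (auto intro: mult_right_mono)
  qed
  finally have qA: "Re (cinner x (A *\<^sub>v x)) \<le> t * Re (cinner x x)"
    by (simp add: na sum_distrib_left)
  have "\<exists>j\<in>{0..<n}. d $ j \<noteq> 0"
  proof (rule ccontr)
    assume "\<not> ?thesis"
    hence "Re (cinner x x) = 0" unfolding nb by simp
    with pos show False by simp
  qed
  then obtain k where k: "k < n" "d $ k \<noteq> 0" by auto
  have "(t + \<epsilon>) * Re (cinner x x) = (\<Sum>j = 0..<n. (t + \<epsilon>) * (cmod (d $ j))\<^sup>2)"
    by (simp add: nb sum_distrib_left)
  also have "\<dots> < (\<Sum>j = 0..<n. b j * (cmod (d $ j))\<^sup>2)"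
  proof (rule sum_strict_mono_ex1)
    show "\<forall>j\<in>{0..<n}. (t + \<epsilon>) * (cmod (d $ j))\<^sup>2 \<le> b j * (cmod (d $ j))\<^sup>2"
    proof
      fix j assume "j \<in> {0..<n}"
      thus "(t + \<epsilon>) * (cmod (d $ j))\<^sup>2 \<le> b j * (cmod (d $ j))\<^sup>2"
        using d0[of j] by (cases "j \<in> ?I") (auto intro: mult_right_mono)
    qed
    show "\<exists>j\<in>{0..<n}. (t + \<epsilon>) * (cmod (d $ j))\<^sup>2 < b j * (cmod (d $ j))\<^sup>2"
      using k d0[of k] by (intro bexI[of _ k] mult_strict_right_mono) (auto simp: not_le[symmetric])
  qed simp
  also have "\<dots> = Re (cinner x (B *\<^sub>v x))"
    unfolding xd using cinner_diagonalized(1)[OF B W BW d] by simp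
  finally show False using le[OF x] qA by (simp add: algebra_simps)
qed

text \<open>Translates between eigenvalue counts and the sorted list; \<open>m\<close> is counted
  from 0, hence the strict inequality on the right.\<close>

lemma sort_nth_le_iff:
  fixes xs :: "'a :: linorder list"
  assumes "m < length xs"
  shows "sort xs ! m \<le> t \<longleftrightarrow> m < length (filter (\<lambda>x. x \<le> t) xs)"
proof -
  define ys where "ys = sort xs"
  have s: "sorted ys" and l: "length ys = length xs" by (auto simp: ys_def)
  have "length (filter (\<lambda>x. x \<le> t) xs) = length (filter (\<lambda>x. x \<le> t) ys)"
    unfolding ys_def by (metis mset_filter mset_sort size_mset)
  also have "\<dots> = card {i. i < length ys \<and> ys ! i \<le> t}" by (rule length_filter_conv_card)
  finally have eq: "length (filter (\<lambda>x. x \<le> t) xs) = card {i. i < length ys \<and> ys ! i \<le> t}" .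
  show ?thesis
  proof (cases "ys ! m \<le> t")
    case True
    have "{0..m} \<subseteq> {i. i < length ys \<and> ys ! i \<le> t}"
      using True s assms l by (auto intro: order.trans[OF sorted_nth_mono])
    hence "card {0..m} \<le> card {i. i < length ys \<and> ys ! i \<le> t}" by (intro card_mono) auto
    thus ?thesis using True eq by (simp add: ys_def)
  next
    case False
    have "{i. i < length ys \<and> ys ! i \<le> t} \<subseteq> {0..<m}"
    proof
      fix i assume i: "i \<in> {i. i < length ys \<and> ys ! i \<le> t}"
      have "\<not> m \<le> i"
      proof
        assume "m \<le> i"
        hence "ys ! m \<le> ys ! i" using i s by (intro sorted_nth_mono) auto
        with i False show False by auto
      qed
      thus "i \<in> {0..<m}" by simp
    qed
    hence "card {i. i < length ys \<and> ys ! i \<le> t} \<le> card {0..<m}" by (intro card_mono) auto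
    thus ?thesis using False eq by (simp add: ys_def)
  qed
qed

lemma char_poly_diagonalized:
  assumes A: "A \<in> carrier_mat n n" and U: "U \<in> carrier_mat n n" "ctranspose U * U = 1\<^sub>m n"
    and AU: "A * U = U * real_diag n b"
  shows "char_poly A = (\<Prod>x\<leftarrow>map b [0..<n]. [:- complex_of_real x, 1:])"
    and "eigenvalues_sorted A = sort (map b [0..<n])"
proof -
  have UU: "U * ctranspose U = 1\<^sub>m n"
    using mat_mult_left_right_inverse[of "ctranspose U" n U] U by simp
  have "A = A * (U * ctranspose U)" using A UU by simp
  also have "\<dots> = U * real_diag n b * ctranspose U"
    unfolding AU[symmetric] using A U by (simp add: assoc_mult_mat[of _ n n _ n _ n])
  finally have "similar_mat_wit A (real_diag n b) U (ctranspose U)"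
    using A U UU unfolding similar_mat_wit_def Let_def by auto
  hence "similar_mat A (real_diag n b)" unfolding similar_mat_def by blast
  hence "char_poly A = char_poly (real_diag n b)" by (rule char_poly_similar)
  also have "\<dots> = (\<Prod>a\<leftarrow>diag_mat (real_diag n b). [:- a, 1:])"
    by (rule char_poly_upper_triangular[of _ n]) (auto simp: real_diag_def)
  also have "diag_mat (real_diag n b) = map (\<lambda>i. of_real (b i)) [0..<n]"
    by (auto simp: diag_mat_def real_diag_def)
  finally show cp: "char_poly A = (\<Prod>x\<leftarrow>map b [0..<n]. [:- complex_of_real x, 1:])"
    by (simp add: o_def)
  have pr: "proots (\<Prod>x\<leftarrow>xs. [:- complex_of_real x, 1:]) = image_mset of_real (mset xs)" for xs
  proof (induction xs)
    case (Cons x xs)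
    have "(\<Prod>x\<leftarrow>xs. [:- complex_of_real x, 1:]) \<noteq> 0"
      by (auto simp: prod_list_zero_iff)
    hence "proots ([:- complex_of_real x, 1:] * (\<Prod>x\<leftarrow>xs. [:- complex_of_real x, 1:])) =
        proots [:- complex_of_real x, 1:] + proots (\<Prod>x\<leftarrow>xs. [:- complex_of_real x, 1:])"
      by (intro proots_mult) simp_all
    also have "\<dots> = {#of_real x#} + image_mset of_real (mset xs)"
      by (simp only: proots_linear_factor minus_minus Cons.IH)
    finally show ?case by (simp del: mult_pCons_left)
  qed simp
  have "image_mset Re (proots (char_poly A)) = image_mset Re (image_mset of_real (mset (map b [0..<n])))"
    unfolding cp pr ..
  also have "\<dots> = mset (map b [0..<n])" by (simp add: multiset.map_comp o_def)
  finally show "eigenvalues_sorted A = sort (map b [0..<n])"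
    unfolding eigenvalues_sorted_def by (simp only: sorted_list_of_multiset_mset)
qed

lemma length_eigenvalues_sorted:
  assumes "A \<in> carrier_mat n n"
  shows "length (eigenvalues_sorted A) = n"
  using degree_monic_char_poly[OF assms]
  by (simp add: eigenvalues_sorted_def size_proots_complex flip: size_mset)

lemma char_poly_hermitian:
  assumes A: "A \<in> carrier_mat n n" "ctranspose A = A"
  shows "poly (char_poly A) (of_real t) = of_real (\<Prod>j = 0..<n. t - eigenvalues_sorted A ! j)"
proof -
  obtain U b where U: "U \<in> carrier_mat n n" "ctranspose U * U = 1\<^sub>m n" "A * U = U * real_diag n b"
    using hermitian_diagonalization[OF A] by blast
  let ?f = "\<lambda>x. complex_of_real (t - x)"
  have "poly (char_poly A) (of_real t) = (\<Prod>x\<leftarrow>map b [0..<n]. ?f x)"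
    unfolding char_poly_diagonalized(1)[OF A(1) U] by (simp add: poly_prod_list o_def)
  also have "\<dots> = prod_mset (image_mset ?f (mset (map b [0..<n])))"
    by (simp only: prod_mset_prod_list mset_map[symmetric])
  also have "mset (map b [0..<n]) = mset (eigenvalues_sorted A)"
    unfolding char_poly_diagonalized(2)[OF A(1) U] by simp
  also have "prod_mset (image_mset ?f \<dots>) = (\<Prod>x\<leftarrow>eigenvalues_sorted A. ?f x)"
    by (simp only: prod_mset_prod_list mset_map[symmetric])
  also have "\<dots> = (\<Prod>j = 0..<n. ?f (eigenvalues_sorted A ! j))"
    using length_eigenvalues_sorted[OF A(1)] by (subst prod.list_conv_set_nth) simp
  finally show ?thesis by simp
qed

text \<open>An entrywise bound \<open>e\<close> changes the quadratic form by at most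
  \<open>n * e\<close> times the squared norm, because the product |x_i| |x_j| is at most the mean
  of the two squares. Passing through counts gives the bound for every position in the sorted list,
  also when eigenvalues coincide.\<close>

lemma eigenvalues_sorted_perturbation:
  assumes A: "A \<in> carrier_mat n n" "ctranspose A = A" and B: "B \<in> carrier_mat n n" "ctranspose B = B"
    and e: "\<And>i j. i < n \<Longrightarrow> j < n \<Longrightarrow> cmod (A $$ (i, j) - B $$ (i, j)) \<le> e" and m: "m < n"
  shows "eigenvalues_sorted B ! m \<le> eigenvalues_sorted A ! m + real n * e"
proof -
  obtain U a where U: "U \<in> carrier_mat n n" "ctranspose U * U = 1\<^sub>m n" "A * U = U * real_diag n a"
    using hermitian_diagonalization[OF A] by blast
  obtain W b where W: "W \<in> carrier_mat n n" "ctranspose W * W = 1\<^sub>m n" "B * W = W * real_diag n b"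
    using hermitian_diagonalization[OF B] by blast
  have e0: "e \<ge> 0" using order.trans[OF norm_ge_zero e[OF m m]] .
  let ?\<epsilon> = "real n * e"
  have quad: "Re (cinner x (B *\<^sub>v x)) \<le> Re (cinner x (A *\<^sub>v x)) + ?\<epsilon> * Re (cinner x x)"
    if x: "x \<in> carrier_vec n" for x
  proof -
    have expand: "cinner x (M *\<^sub>v x) = (\<Sum>i = 0..<n. \<Sum>j = 0..<n. cnj (x $ i) * M $$ (i, j) * x $ j)"
      if "M \<in> carrier_mat n n" for M
      using that x by (auto simp: cinner_def scalar_prod_def sum_distrib_left mult_ac intro!: sum.cong)
    let ?N = "\<Sum>i = 0..<n. (cmod (x $ i))\<^sup>2"
    have "cmod (cinner x (B *\<^sub>v x) - cinner x (A *\<^sub>v x)) =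
      cmod (\<Sum>i = 0..<n. \<Sum>j = 0..<n. cnj (x $ i) * (B $$ (i, j) - A $$ (i, j)) * x $ j)"
      unfolding expand[OF A(1)] expand[OF B(1)] sum_subtractf[symmetric] by (simp add: algebra_simps)
    also have "\<dots> \<le> (\<Sum>i = 0..<n. \<Sum>j = 0..<n. e * (((cmod (x $ i))\<^sup>2 + (cmod (x $ j))\<^sup>2) / 2))"
    proof (rule order.trans[OF norm_sum], rule sum_mono, rule order.trans[OF norm_sum], rule sum_mono)
      fix i j assume ij: "i \<in> {0..<n}" "j \<in> {0..<n}"
      have "cmod (cnj (x $ i) * (B $$ (i, j) - A $$ (i, j)) * x $ j) =
          cmod (A $$ (i, j) - B $$ (i, j)) * (cmod (x $ i) * cmod (x $ j))"
        by (simp add: norm_mult norm_minus_commute)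
      also have "\<dots> \<le> e * (((cmod (x $ i))\<^sup>2 + (cmod (x $ j))\<^sup>2) / 2)"
        using e ij e0 sum_squares_bound[of "cmod (x $ i)" "cmod (x $ j)"] by (intro mult_mono) auto
      finally show "cmod (cnj (x $ i) * (B $$ (i, j) - A $$ (i, j)) * x $ j) \<le> \<dots>" .
    qed
    also have "\<dots> = (\<Sum>i = 0..<n. e * ((real n * (cmod (x $ i))\<^sup>2 + ?N) / 2))"
      by (simp add: sum.distrib add_divide_distrib sum_divide_distrib flip: sum_distrib_left)
    also have "\<dots> = e * ((real n * ?N + real n * ?N) / 2)"
      by (simp add: sum.distrib flip: sum_distrib_left sum_divide_distrib)
    also have "\<dots> = ?\<epsilon> * Re (cinner x x)" using x by (simp add: cinner_self)
    finally have "cmod (cinner x (B *\<^sub>v x) - cinner x (A *\<^sub>v x)) \<le> ?\<epsilon> * Re (cinner x x)" .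
    thus ?thesis using complex_Re_le_cmod[of "cinner x (B *\<^sub>v x) - cinner x (A *\<^sub>v x)"] by simp
  qed
  have cnt: "length (filter (\<lambda>x. x \<le> s) (map f [0..<n])) = card {j \<in> {0..<n}. f j \<le> s}"
    for s :: real and f :: "nat \<Rightarrow> real"
    by (subst length_filter_conv_card) (auto intro!: arg_cong[of _ _ card])
  define t where "t = eigenvalues_sorted A ! m"
  have "m < card {j \<in> {0..<n}. a j \<le> t}"
    using sort_nth_le_iff[of m "map a [0..<n]" t] m unfolding cnt
    by (simp add: t_def char_poly_diagonalized(2)[OF A(1) U])
  also have "\<dots> \<le> card {j \<in> {0..<n}. b j \<le> t + ?\<epsilon>}"
    by (rule weyl_count[OF A(1) U B(1) W quad])
  finally show ?thesis
    using sort_nth_le_iff[of m "map b [0..<n]" "t + ?\<epsilon>"] m unfolding cnt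
    by (simp add: t_def char_poly_diagonalized(2)[OF B(1) W])
qed

section \<open>Asymptotics of hopping determinants\<close>

text \<open>The derivation \<open>y d/dy\<close> preserves the growth order, which makes the class multiplicative.\<close>

definition tame :: "nat \<Rightarrow> (complex \<Rightarrow> complex \<Rightarrow> complex) \<Rightarrow> bool" where
  "tame d f \<longleftrightarrow> (\<exists>C f'. C \<ge> 0 \<and> (\<forall>x y. 1 \<le> norm x \<longrightarrow> 1 \<le> norm y \<longrightarrow>
     (f x has_field_derivative f' x y) (at y) \<and>
     norm (f x y) \<le> C * max (norm x) (norm y) ^ d \<and>
     norm (y * f' x y) \<le> C * max (norm x) (norm y) ^ d))"

lemma tameI:
  assumes "C \<ge> 0"
    and "\<And>x y. 1 \<le> norm x \<Longrightarrow> 1 \<le> norm y \<Longrightarrow> (f x has_field_derivative f' x y) (at y)"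
    and "\<And>x y. 1 \<le> norm x \<Longrightarrow> 1 \<le> norm y \<Longrightarrow> norm (f x y) \<le> C * max (norm x) (norm y) ^ d"
    and "\<And>x y. 1 \<le> norm x \<Longrightarrow> 1 \<le> norm y \<Longrightarrow> norm (y * f' x y) \<le> C * max (norm x) (norm y) ^ d"
  shows "tame d f"
  unfolding tame_def using assms by blast

lemma tameE:
  assumes "tame d f"
  obtains C f' where "C \<ge> 0"
    "\<And>x y. 1 \<le> norm x \<Longrightarrow> 1 \<le> norm y \<Longrightarrow> (f x has_field_derivative f' x y) (at y)"
    "\<And>x y. 1 \<le> norm x \<Longrightarrow> 1 \<le> norm y \<Longrightarrow> norm (f x y) \<le> C * max (norm x) (norm y) ^ d"
    "\<And>x y. 1 \<le> norm x \<Longrightarrow> 1 \<le> norm y \<Longrightarrow> norm (y * f' x y) \<le> C * max (norm x) (norm y) ^ d"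
  using assms unfolding tame_def by blast

lemma tame_const: "tame d (\<lambda>x y. c)"
proof (rule tameI[where C = "norm c" and f' = "\<lambda>x y. 0"])
  fix x y :: complex assume "1 \<le> norm x" "1 \<le> norm y"
  hence "1 \<le> max (norm x) (norm y) ^ d" by (intro one_le_power) auto
  thus "norm c \<le> norm c * max (norm x) (norm y) ^ d"
    using mult_left_mono[of 1 "max (norm x) (norm y) ^ d" "norm c"] by simp
qed auto

lemma tame_fst: "tame 1 (\<lambda>x y. x)"
  by (rule tameI[where C = 1 and f' = "\<lambda>x y. 0"]) (auto simp: le_max_iff_disj)

lemma tame_snd: "tame 1 (\<lambda>x y. y)"
  by (rule tameI[where C = 1 and f' = "\<lambda>x y. 1"]) auto

text \<open>The restriction to |x|, |y| \<ge> 1 is what gives the inverses growth order 0.\<close>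

lemma tame_inverse_fst: "tame 0 (\<lambda>x y. inverse x)"
  by (rule tameI[where C = 1 and f' = "\<lambda>x y. 0"]) (auto simp: norm_inverse inverse_le_1_iff)

lemma tame_inverse_snd: "tame 0 (\<lambda>x y. inverse y)"
proof (rule tameI[where C = 1 and f' = "\<lambda>x y. - (inverse y ^ 2)"])
  fix x y :: complex assume y: "1 \<le> norm y"
  hence "y \<noteq> 0" by auto
  thus "(inverse has_field_derivative - (inverse y ^ 2)) (at y)"
    using DERIV_inverse[of y UNIV] by (simp add: numeral_2_eq_2)
  have "y * - (inverse y ^ 2) = - inverse y" using \<open>y \<noteq> 0\<close> by (simp add: power2_eq_square)
  thus "norm (y * - (inverse y ^ 2)) \<le> 1 * max (norm x) (norm y) ^ 0"
    using y by (simp add: norm_inverse inverse_le_1_iff)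
qed (auto simp: norm_inverse inverse_le_1_iff)

lemma tame_add:
  assumes "tame d f" "tame d g"
  shows "tame d (\<lambda>x y. f x y + g x y)"
proof -
  obtain C f' where f: "C \<ge> 0"
    "\<And>x y. 1 \<le> norm x \<Longrightarrow> 1 \<le> norm y \<Longrightarrow> (f x has_field_derivative f' x y) (at y)"
    "\<And>x y. 1 \<le> norm x \<Longrightarrow> 1 \<le> norm y \<Longrightarrow> norm (f x y) \<le> C * max (norm x) (norm y) ^ d"
    "\<And>x y. 1 \<le> norm x \<Longrightarrow> 1 \<le> norm y \<Longrightarrow> norm (y * f' x y) \<le> C * max (norm x) (norm y) ^ d"
    using tameE[OF assms(1)] by metis
  obtain D g' where g: "D \<ge> 0"
    "\<And>x y. 1 \<le> norm x \<Longrightarrow> 1 \<le> norm y \<Longrightarrow> (g x has_field_derivative g' x y) (at y)"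
    "\<And>x y. 1 \<le> norm x \<Longrightarrow> 1 \<le> norm y \<Longrightarrow> norm (g x y) \<le> D * max (norm x) (norm y) ^ d"
    "\<And>x y. 1 \<le> norm x \<Longrightarrow> 1 \<le> norm y \<Longrightarrow> norm (y * g' x y) \<le> D * max (norm x) (norm y) ^ d"
    using tameE[OF assms(2)] by metis
  show ?thesis
  proof (rule tameI[where C = "C + D" and f' = "\<lambda>x y. f' x y + g' x y"])
    fix x y :: complex assume xy: "1 \<le> norm x" "1 \<le> norm y"
    show "((\<lambda>y. f x y + g x y) has_field_derivative f' x y + g' x y) (at y)"
      by (intro DERIV_add f g xy)
    show "norm (f x y + g x y) \<le> (C + D) * max (norm x) (norm y) ^ d"
      using norm_triangle_ineq[of "f x y" "g x y"] f(3)[OF xy] g(3)[OF xy]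
      by (simp add: distrib_right)
    show "norm (y * (f' x y + g' x y)) \<le> (C + D) * max (norm x) (norm y) ^ d"
      using norm_triangle_ineq[of "y * f' x y" "y * g' x y"] f(4)[OF xy] g(4)[OF xy]
      by (simp add: distrib_right distrib_left)
  qed (use f g in auto)
qed

lemma tame_mult:
  assumes "tame d f" "tame e g"
  shows "tame (d + e) (\<lambda>x y. f x y * g x y)"
proof -
  obtain C f' where f: "C \<ge> 0"
    "\<And>x y. 1 \<le> norm x \<Longrightarrow> 1 \<le> norm y \<Longrightarrow> (f x has_field_derivative f' x y) (at y)"
    "\<And>x y. 1 \<le> norm x \<Longrightarrow> 1 \<le> norm y \<Longrightarrow> norm (f x y) \<le> C * max (norm x) (norm y) ^ d"
    "\<And>x y. 1 \<le> norm x \<Longrightarrow> 1 \<le> norm y \<Longrightarrow> norm (y * f' x y) \<le> C * max (norm x) (norm y) ^ d"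
    using tameE[OF assms(1)] by metis
  obtain D g' where g: "D \<ge> 0"
    "\<And>x y. 1 \<le> norm x \<Longrightarrow> 1 \<le> norm y \<Longrightarrow> (g x has_field_derivative g' x y) (at y)"
    "\<And>x y. 1 \<le> norm x \<Longrightarrow> 1 \<le> norm y \<Longrightarrow> norm (g x y) \<le> D * max (norm x) (norm y) ^ e"
    "\<And>x y. 1 \<le> norm x \<Longrightarrow> 1 \<le> norm y \<Longrightarrow> norm (y * g' x y) \<le> D * max (norm x) (norm y) ^ e"
    using tameE[OF assms(2)] by metis
  have bound: "norm (u * v) \<le> C * D * T ^ (d + e)"
    if "norm u \<le> C * T ^ d" "norm v \<le> D * T ^ e" "T \<ge> 0" for u v :: complex and T
  proof -
    have "norm u * norm v \<le> (C * T ^ d) * (D * T ^ e)"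
      using that f(1) g(1) by (intro mult_mono) auto
    thus ?thesis by (simp add: norm_mult power_add mult_ac)
  qed
  show ?thesis
  proof (rule tameI[where C = "2 * C * D" and f' = "\<lambda>x y. f' x y * g x y + g' x y * f x y"])
    fix x y :: complex assume xy: "1 \<le> norm x" "1 \<le> norm y"
    let ?T = "max (norm x) (norm y)"
    have T: "?T \<ge> 0" by (simp add: le_max_iff_disj)
    show "((\<lambda>y. f x y * g x y) has_field_derivative f' x y * g x y + g' x y * f x y) (at y)"
      by (intro DERIV_mult f g xy)
    have CD: "0 \<le> C * D * ?T ^ (d + e)" using f(1) g(1) T by simp
    show "norm (f x y * g x y) \<le> 2 * C * D * ?T ^ (d + e)"
      using bound[OF f(3)[OF xy] g(3)[OF xy] T] CD by simp
    have "y * (f' x y * g x y + g' x y * f x y) = (y * f' x y) * g x y + f x y * (y * g' x y)"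
      by (simp add: algebra_simps)
    also have "norm \<dots> \<le> C * D * ?T ^ (d + e) + C * D * ?T ^ (d + e)"
      by (rule order.trans[OF norm_triangle_ineq])
         (intro add_mono bound f(3,4)[OF xy] g(3,4)[OF xy] T)
    finally show "norm (y * (f' x y * g x y + g' x y * f x y)) \<le> 2 * C * D * ?T ^ (d + e)" by simp
  qed (use f g in auto)
qed

lemma tame_mono:
  assumes "tame d f" "d \<le> e"
  shows "tame e f"
  using tame_mult[OF assms(1) tame_const[of "e - d" 1]] assms(2) by simp

lemma tame_sum:
  assumes "\<And>i. i \<in> I \<Longrightarrow> tame d (f i)"
  shows "tame d (\<lambda>x y. \<Sum>i\<in>I. f i x y)"
  using assms by (induction I rule: infinite_finite_induct) (auto intro: tame_const tame_add)

lemma tame_prod: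
  assumes "\<And>i. i \<in> I \<Longrightarrow> tame 1 (f i)"
  shows "tame (card I) (\<lambda>x y. \<Prod>i\<in>I. f i x y)"
  using assms
proof (induction I rule: infinite_finite_induct)
  case (insert i I)
  thus ?case using tame_mult[of 1 "f i" "card I"] by simp
qed (auto intro: tame_const)

text \<open>Every term of the expanded difference contains at least one bounded factor
  \<open>e i\<close> in place of a factor of growth order 1, which costs one order.\<close>

lemma tame_prod_add_diff:
  assumes "finite I" "\<And>i. i \<in> I \<Longrightarrow> tame 1 (a i)" "\<And>i. i \<in> I \<Longrightarrow> tame 0 (e i)"
  shows "tame (card I - 1) (\<lambda>x y. (\<Prod>i\<in>I. a i x y + e i x y) - (\<Prod>i\<in>I. a i x y))"
  using assms
proof (induction I rule: finite_induct)
  case empty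
  show ?case by (simp add: tame_const)
next
  case (insert i I)
  let ?P = "\<lambda>x y. \<Prod>i\<in>I. a i x y + e i x y" and ?R = "\<lambda>x y. \<Prod>i\<in>I. a i x y"
  have P: "tame (card I) ?P"
    by (rule tame_prod, rule tame_add) (use insert.prems in \<open>auto intro: tame_mono[of 0]\<close>)
  have "tame (card I) (\<lambda>x y. a i x y * (?P x y - ?R x y))"
  \<comment> \<open>For empty \<open>I\<close> the truncated \<open>card I - 1\<close> is 0 and the
    product rule would give growth order 1 instead of 0; there the difference itself is 0.\<close>
  proof (cases "I = {}")
    case True
    thus ?thesis by (simp add: tame_const)
  next
    case False
    hence "1 + (card I - 1) = card I" using insert.hyps(1) by (simp add: card_gt_0_iff Suc_leI)
    thus ?thesis using tame_mult[of 1 "a i" "card I - 1"] insert by simp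
  qed
  moreover have "tame (card I) (\<lambda>x y. e i x y * ?P x y)"
    using tame_mult[of 0 "e i" "card I" ?P] P insert by simp
  ultimately have "tame (card I) (\<lambda>x y. a i x y * (?P x y - ?R x y) + e i x y * ?P x y)"
    by (rule tame_add)
  thus ?case using insert.hyps by (simp add: algebra_simps)
qed

lemma tame_det_add_diff:
  assumes "\<And>i j. i < n \<Longrightarrow> j < n \<Longrightarrow> tame 1 (a i j)" "\<And>i j. i < n \<Longrightarrow> j < n \<Longrightarrow> tame 0 (e i j)"
  shows "tame (n - 1) (\<lambda>x y. det (mat n n (\<lambda>(i, j). a i j x y + e i j x y))
    - det (mat n n (\<lambda>(i, j). a i j x y)))"
proof -
  have "tame (n - 1) (\<lambda>x y. \<Sum>p | p permutes {0..<n}. signof p *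
      ((\<Prod>i = 0..<n. a i (p i) x y + e i (p i) x y) - (\<Prod>i = 0..<n. a i (p i) x y)))"
  proof (rule tame_sum, clarify)
    fix p assume p: "p permutes {0..<n}"
    hence pn: "p i < n" if "i < n" for i using permutes_in_image[OF p, of i] that by simp
    have "tame (card {0..<n} - 1)
        (\<lambda>x y. (\<Prod>i = 0..<n. a i (p i) x y + e i (p i) x y) - (\<Prod>i = 0..<n. a i (p i) x y))"
      by (rule tame_prod_add_diff) (use assms pn in auto)
    from tame_mult[OF tame_const[of 0 "signof p"] this]
    show "tame (n - 1) (\<lambda>x y. signof p *
        ((\<Prod>i = 0..<n. a i (p i) x y + e i (p i) x y) - (\<Prod>i = 0..<n. a i (p i) x y)))" by simp
  qed
  also have "(\<lambda>x y. \<Sum>p | p permutes {0..<n}. signof p *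
      ((\<Prod>i = 0..<n. a i (p i) x y + e i (p i) x y) - (\<Prod>i = 0..<n. a i (p i) x y))) =
    (\<lambda>x y. det (mat n n (\<lambda>(i, j). a i j x y + e i j x y)) - det (mat n n (\<lambda>(i, j). a i j x y)))"
  proof (intro ext)
    fix x y
    have det: "det (mat n n (\<lambda>(i, j). b i j)) =
      (\<Sum>p | p permutes {0..<n}. signof p * (\<Prod>i = 0..<n. b i (p i)))" for b :: "nat \<Rightarrow> nat \<Rightarrow> complex"
    proof (subst det_def'[of _ n], simp, rule sum.cong[OF refl])
      fix p assume "p \<in> {p. p permutes {0..<n}}"
      hence p: "p permutes {0..<n}" by simp
      hence pn: "p i < n" if "i < n" for i using permutes_in_image[OF p, of i] that by simp
      show "signof p * (\<Prod>i = 0..<n. mat n n (\<lambda>(i, j). b i j) $$ (i, p i)) =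
          signof p * (\<Prod>i = 0..<n. b i (p i))"
        by (intro arg_cong2[of _ _ _ _ "(*)"] prod.cong) (use pn in auto)
    qed
    show "(\<Sum>p | p permutes {0..<n}. signof p *
      ((\<Prod>i = 0..<n. a i (p i) x y + e i (p i) x y) - (\<Prod>i = 0..<n. a i (p i) x y))) =
      det (mat n n (\<lambda>(i, j). a i j x y + e i j x y)) - det (mat n n (\<lambda>(i, j). a i j x y))"
      unfolding det by (simp add: right_diff_distrib sum_subtractf)
  qed
  finally show ?thesis .
qed

section \<open>Determinants of matrices built from two permutations\<close>

lemma det_cyclic_bidiagonal:
  fixes x y :: "'a :: idom"
  assumes n: "n > 0"
  shows "det (mat n n (\<lambda>(i, j). (if j = Suc i mod n then x else 0) + (if j = i then y else 0))) =
    y ^ n + (-1) ^ (n - 1) * x ^ n"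
proof (cases "n = 1")
  case True
  thus ?thesis by (subst det_single) (auto simp: add.commute)
next
  case False
  then obtain k where k: "n = Suc k" "k > 0" using n by (cases n) auto
  define A where "A = mat n n (\<lambda>(i, j). (if j = Suc i mod n then x else 0) + (if j = i then y else 0))"
  have A: "A \<in> carrier_mat n n" by (simp add: A_def)
  have dim: "dim_row A = Suc k" "dim_col A = Suc k" using A k by auto
  \<comment> \<open>Column 0 has entries only in row 0 and in the last row \<open>k\<close>, where
    the cycle closes. Deleting row 0 leaves an upper triangular minor with \<open>y\<close> on the
    diagonal, deleting row \<open>k\<close> a lower triangular one with \<open>x\<close>.\<close>
  have del: "mat_delete A 0 0 $$ (i, j) = (if j = Suc i then x else 0) + (if j = i then y else 0)"
    if "i < k" "j < k" for i j
  proof -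
    have "Suc j = Suc (Suc i) mod Suc k \<longleftrightarrow> j = Suc i"
      using that by (cases "Suc (Suc i) = Suc k") (auto simp: mod_if)
    thus ?thesis using that by (simp add: mat_delete_def A_def k)
  qed
  have "det (mat_delete A 0 0) = prod_list (diag_mat (mat_delete A 0 0))"
  proof (rule det_upper_triangular[of _ k])
    show "upper_triangular (mat_delete A 0 0)"
      unfolding upper_triangular_def
    proof (intro allI impI)
      fix i j assume "i < dim_row (mat_delete A 0 0)" "j < i"
      thus "mat_delete A 0 0 $$ (i, j) = 0" using del[of i j] dim by simp
    qed
  qed (rule carrier_matI; simp add: dim)
  also have "diag_mat (mat_delete A 0 0) = map (\<lambda>i. y) [0..<k]"
    unfolding diag_mat_def by (rule map_cong) (simp_all add: del dim)
  finally have c0: "det (mat_delete A 0 0) = y ^ k" by (simp add: map_replicate_const)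
  have del': "mat_delete A k 0 $$ (i, j) = (if j = i then x else 0) + (if Suc j = i then y else 0)"
    if "i < k" "j < k" for i j
    using that by (simp add: mat_delete_def A_def k)
  have "det (mat_delete A k 0) = prod_list (diag_mat (mat_delete A k 0))"
    by (rule det_lower_triangular[of k]) (auto simp: del' dim intro: carrier_matI)
  also have "diag_mat (mat_delete A k 0) = map (\<lambda>i. x) [0..<k]"
    unfolding diag_mat_def by (rule map_cong) (simp_all add: del' dim)
  finally have ck: "det (mat_delete A k 0) = x ^ k" by (simp add: map_replicate_const)
  have entry: "A $$ (i, 0) = (if i = k then x else 0) + (if i = 0 then y else 0)" if "i < n" for i
    using that k by (auto simp: A_def mod_if)
  have "det A = (\<Sum>i<n. A $$ (i, 0) * cofactor A i 0)"
    by (rule laplace_expansion_column[OF A n])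
  also have "\<dots> = (\<Sum>i<n. (if i = k then x * cofactor A k 0 else 0) + (if i = 0 then y * cofactor A 0 0 else 0))"
    by (rule sum.cong) (use k in \<open>auto simp: entry\<close>)
  also have "\<dots> = x * cofactor A k 0 + y * cofactor A 0 0"
    using k by (simp add: sum.distrib)
  also have "\<dots> = y ^ n + (-1) ^ (n - 1) * x ^ n"
    unfolding cofactor_def c0 ck by (simp add: k)
  finally show ?thesis by (simp only: A_def)
qed

lemma det_permute_rows_cols:
  assumes A: "A \<in> carrier_mat n n" and p: "p permutes {0..<n}" and q: "q permutes {0..<n}"
  shows "det (mat n n (\<lambda>(i, j). A $$ (p i, q j))) = signof p * signof q * det A"
proof -
  let ?B = "mat n n (\<lambda>(i, j). transpose_mat A $$ (q i, j))"
  have B: "transpose_mat ?B \<in> carrier_mat n n" by simp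
  have pn: "p i < n" and qn: "q i < n" if "i < n" for i
    using permutes_in_image[OF p, of i] permutes_in_image[OF q, of i] that by auto
  have "mat n n (\<lambda>(i, j). A $$ (p i, q j)) = mat n n (\<lambda>(i, j). transpose_mat ?B $$ (p i, j))"
    by (rule eq_matI) (use A pn qn in auto)
  also have "det \<dots> = signof p * det (transpose_mat ?B)" by (rule det_permute_rows[OF B p])
  also have "det (transpose_mat ?B) = det ?B" by (rule det_transpose[of _ n]) simp
  also have "\<dots> = signof q * det (transpose_mat A)" by (rule det_permute_rows[OF _ q]) (use A in simp)
  also have "det (transpose_mat A) = det A" by (rule det_transpose[OF A])
  finally show ?thesis by simp
qed

text \<open>The hypothesis says that \<open>r\<^sup>-\<^sup>1 \<circ> p\<close> is the \<open>n\<close>-cycle \<open>e 0 \<mapsto> e 1 \<mapsto> \<dots>\<close>; hence only the two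
  pure terms of the Leibniz expansion survive.\<close>

lemma det_two_permutations:
  fixes p r e :: "nat \<Rightarrow> nat"
  assumes n: "n > 0" and r: "bij_betw r {0..<n} {0..<n}" and e: "bij_betw e {0..<n} {0..<n}"
    and cyc: "\<And>t. t < n \<Longrightarrow> p (e t) = r (e (Suc t mod n))"
  obtains c1 c2 :: complex where "norm c1 = 1" "norm c2 = 1"
    "\<And>x y. det (mat n n (\<lambda>(i, j). (if p i = j then x else 0) + (if r i = j then y else 0))) =
      c1 * x ^ n + c2 * y ^ n"
proof -
  \<comment> \<open>Listing the rows in the order \<open>e\<close> and the columns in the order
    \<open>r\<close> after \<open>e\<close> turns the matrix into the cyclic bidiagonal one. Both
    orders are extended by the identity to become permutations in the library sense.\<close>
  define e' where "e' i = (if i < n then e i else i)" for i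
  define f' where "f' i = (if i < n then r (e i) else i)" for i
  have re: "bij_betw (r \<circ> e) {0..<n} {0..<n}" by (rule bij_betw_trans[OF e r])
  have "bij_betw e' {0..<n} {0..<n}" using e by (rule bij_betw_cong[THEN iffD1, rotated]) (simp add: e'_def)
  hence e': "e' permutes {0..<n}" by (rule bij_imp_permutes) (auto simp: e'_def)
  have "bij_betw f' {0..<n} {0..<n}" using re by (rule bij_betw_cong[THEN iffD1, rotated]) (simp add: f'_def)
  hence f': "f' permutes {0..<n}" by (rule bij_imp_permutes) (auto simp: f'_def)
  define s where "s = (signof e' * signof f' :: complex)"
  have s: "s * s = 1" "norm s = 1" by (auto simp: s_def sign_def)
  have en: "e i < n" "r (e i) < n" if "i < n" for i
    using bij_betwE[OF e] bij_betwE[OF re] that by auto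
  have inj: "r (e i) = r (e j) \<longleftrightarrow> i = j" if "i < n" "j < n" for i j
    using bij_betw_imp_inj_on[OF re] that by (auto simp: inj_on_def)
  show ?thesis
  proof (rule that[of "s * (-1) ^ (n - 1)" s])
    fix x y :: complex
    let ?K = "mat n n (\<lambda>(i, j). (if p i = j then x else 0) + (if r i = j then y else 0))"
    have "s * det ?K = det (mat n n (\<lambda>(i, j). ?K $$ (e' i, f' j)))"
      unfolding s_def by (rule det_permute_rows_cols[OF _ e' f', symmetric]) simp
    also have "mat n n (\<lambda>(i, j). ?K $$ (e' i, f' j)) =
        mat n n (\<lambda>(i, j). (if j = Suc i mod n then x else 0) + (if j = i then y else 0))"
    proof (rule eq_matI, goal_cases)
      case (1 i j)
      hence ij: "i < n" "j < n" by auto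
      have "?K $$ (e' i, f' j) = (if p (e i) = r (e j) then x else 0) + (if r (e i) = r (e j) then y else 0)"
        using ij en by (simp add: e'_def f'_def)
      also have "\<dots> = (if j = Suc i mod n then x else 0) + (if j = i then y else 0)"
        using inj[of "Suc i mod n" j] inj[of i j] ij n by (auto simp: cyc)
      finally show ?case using ij by simp
    qed auto
    also have "det \<dots> = y ^ n + (-1) ^ (n - 1) * x ^ n" by (rule det_cyclic_bidiagonal[OF n])
    finally have "s * (s * det ?K) = s * (y ^ n + (-1) ^ (n - 1) * x ^ n)" by simp
    thus "det ?K = s * (-1) ^ (n - 1) * x ^ n + s * y ^ n"
      unfolding mult.assoc[symmetric] s(1) by (simp add: algebra_simps)
  qed (use s in \<open>auto simp: norm_mult norm_power\<close>)
qed

text \<open>In the application \<open>p\<close>, \<open>r\<close> are the unit shifts in the two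
  directions, \<open>p'\<close>, \<open>r'\<close> their inverses, and \<open>w\<close> is the
  spectral parameter minus the potential. Keeping the four maps as parameters lets the regime of
  small \<open>y\<close> be treated by exchanging \<open>r\<close> and \<open>r'\<close>.\<close>

definition hop_mat :: "nat \<Rightarrow> (nat \<Rightarrow> complex) \<Rightarrow> (nat \<Rightarrow> nat) \<Rightarrow> (nat \<Rightarrow> nat) \<Rightarrow> (nat \<Rightarrow> nat) \<Rightarrow> (nat \<Rightarrow> nat)
    \<Rightarrow> complex \<Rightarrow> complex \<Rightarrow> complex mat" where
  "hop_mat n w p p' r r' x y = mat n n (\<lambda>(i, j). (if i = j then w i else 0)
     + (if p i = j then x else 0) + (if p' i = j then inverse x else 0)
     + (if r i = j then y else 0) + (if r' i = j then inverse y else 0))"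

text \<open>The entries split into a part of growth order 1, carried by \<open>p\<close> and
  \<open>r\<close>, and a part bounded for |x|, |y| \<ge> 1; the latter affects the determinant only
  in order \<open>n - 1\<close>.\<close>

lemma hop_mat_det_asymptotics:
  assumes n: "n > 0" and r: "bij_betw r {0..<n} {0..<n}" and e: "bij_betw e {0..<n} {0..<n}"
    and cyc: "\<And>t. t < n \<Longrightarrow> p (e t) = r (e (Suc t mod n))"
  obtains c1 c2 R where "norm c1 = 1" "norm c2 = 1" "tame (n - 1) R"
    "\<And>x y. det (hop_mat n w p p' r r' x y) = c1 * x ^ n + c2 * y ^ n + R x y"
proof -
  obtain c1 c2 :: complex where c: "norm c1 = 1" "norm c2 = 1"
    "\<And>x y. det (mat n n (\<lambda>(i, j). (if p i = j then x else 0) + (if r i = j then y else 0))) =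
      c1 * x ^ n + c2 * y ^ n"
    using det_two_permutations[OF n r e cyc] by blast
  let ?a = "\<lambda>i j x y. (if p i = j then x else 0) + (if r i = j then y else 0)"
  let ?e = "\<lambda>i j x y. (if i = j then w i else 0) + (if p' i = j then inverse x else 0)
    + (if r' i = j then inverse y else 0)"
  have eq: "hop_mat n w p p' r r' x y = mat n n (\<lambda>(i, j). ?a i j x y + ?e i j x y)" for x y
    unfolding hop_mat_def by (rule eq_matI) auto
  have "tame (n - 1) (\<lambda>x y. det (mat n n (\<lambda>(i, j). ?a i j x y + ?e i j x y))
      - det (mat n n (\<lambda>(i, j). ?a i j x y)))"
  proof (rule tame_det_add_diff)
    fix i j
    show "tame 1 (?a i j)"
      by (rule tame_add; cases "p i = j"; cases "r i = j") (auto intro: tame_const tame_fst tame_snd simp del: One_nat_def)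
    show "tame 0 (?e i j)"
      by (rule tame_add, rule tame_add; cases "p' i = j"; cases "r' i = j"; cases "i = j")
         (auto intro: tame_const tame_inverse_fst tame_inverse_snd)
  qed
  from that[OF c(1,2) this] show ?thesis unfolding eq c(3) by simp
qed

text \<open>Let \<open>T\<close> be the maximum of |x| and |y|. A vanishing y-derivative bounds
  |y|^n by \<open>C * T ^ (n - 1)\<close>, and a vanishing determinant then bounds |x|^n by twice
  that. One of the two powers equals \<open>T ^ n\<close>, which is larger once
  \<open>T > 2 * C\<close>; hence the threshold \<open>2 * C + 1\<close>.\<close>

lemma hop_mat_no_double_root:
  assumes n: "n > 0" and r: "bij_betw r {0..<n} {0..<n}" and e: "bij_betw e {0..<n} {0..<n}"
    and cyc: "\<And>t. t < n \<Longrightarrow> p (e t) = r (e (Suc t mod n))"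
  obtains K where "K \<ge> 1" "\<And>x y. norm x \<ge> K \<Longrightarrow> norm y \<ge> 1 \<Longrightarrow> det (hop_mat n w p p' r r' x y) = 0 \<Longrightarrow>
    \<not> ((\<lambda>y. det (hop_mat n w p p' r r' x y)) has_field_derivative 0) (at y)"
proof -
  obtain c1 c2 R where c: "norm c1 = 1" "norm c2 = 1" and R: "tame (n - 1) R"
    and det: "\<And>x y. det (hop_mat n w p p' r r' x y) = c1 * x ^ n + c2 * y ^ n + R x y"
    using hop_mat_det_asymptotics[OF n r e cyc] by metis
  obtain C R' where C: "C \<ge> 0"
    and R': "\<And>x y. 1 \<le> norm x \<Longrightarrow> 1 \<le> norm y \<Longrightarrow> (R x has_field_derivative R' x y) (at y)"
    and bR: "\<And>x y. 1 \<le> norm x \<Longrightarrow> 1 \<le> norm y \<Longrightarrow> norm (R x y) \<le> C * max (norm x) (norm y) ^ (n - 1)"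
    and bR': "\<And>x y. 1 \<le> norm x \<Longrightarrow> 1 \<le> norm y \<Longrightarrow> norm (y * R' x y) \<le> C * max (norm x) (norm y) ^ (n - 1)"
    using tameE[OF R] by metis
  show ?thesis
  proof (rule that[of "2 * C + 1"])
    fix x y assume x: "norm x \<ge> 2 * C + 1" and y: "norm y \<ge> 1" and 0: "det (hop_mat n w p p' r r' x y) = 0"
    have x1: "norm x \<ge> 1" using x C by simp
    define T where "T = max (norm x) (norm y)"
    have T: "T > 2 * C" "T > 0" using x C unfolding T_def by linarith+
    have Tn: "T ^ n = T * T ^ (n - 1)" using n by (cases n) auto
    hence big: "T ^ n > 2 * (C * T ^ (n - 1))" using T by (simp add: mult.assoc[symmetric])
    show "\<not> ((\<lambda>y. det (hop_mat n w p p' r r' x y)) has_field_derivative 0) (at y)"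
    proof
      assume d0: "((\<lambda>y. det (hop_mat n w p p' r r' x y)) has_field_derivative 0) (at y)"
      have "((\<lambda>y. det (hop_mat n w p p' r r' x y)) has_field_derivative
          c2 * (of_nat n * y ^ (n - 1)) + R' x y) (at y)"
        unfolding det by (auto intro!: derivative_eq_intros R'[OF x1 y])
      from DERIV_unique[OF d0 this] have "c2 * (of_nat n * (y * y ^ (n - 1))) + y * R' x y = 0"
        by (metis (no_types, opaque_lifting) distrib_left mult.left_commute mult_zero_right)
      hence "c2 * (of_nat n * y ^ n) = - (y * R' x y)"
        using n by (cases n) (auto simp: add_eq_0_iff)
      hence "norm (c2 * (of_nat n * y ^ n)) = norm (y * R' x y)" by simp
      hence "real n * norm y ^ n = norm (y * R' x y)"
        by (simp add: norm_mult norm_power c)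
      also have "\<dots> \<le> C * T ^ (n - 1)" using bR'[OF x1 y] by (simp add: T_def)
      finally have "real n * norm y ^ n \<le> C * T ^ (n - 1)" .
      moreover have "norm y ^ n \<le> real n * norm y ^ n"
        using n mult_right_mono[of 1 "real n" "norm y ^ n"] by simp
      ultimately have yb: "norm y ^ n \<le> C * T ^ (n - 1)" by linarith
      have "c1 * x ^ n = - (c2 * y ^ n + R x y)" using 0 unfolding det
        by (simp add: add_eq_0_iff2 add.assoc)
      hence "norm (c1 * x ^ n) = norm (c2 * y ^ n + R x y)" by (simp only: norm_minus_cancel)
      hence "norm x ^ n = norm (c2 * y ^ n + R x y)" by (simp add: norm_mult norm_power c)
      also have "\<dots> \<le> norm y ^ n + C * T ^ (n - 1)"
        by (rule order.trans[OF norm_triangle_ineq])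
           (use bR[OF x1 y] c in \<open>simp add: norm_mult norm_power T_def\<close>)
      finally have xb: "norm x ^ n \<le> 2 * (C * T ^ (n - 1))" using yb by simp
      have "T = norm x \<or> T = norm y" by (auto simp: T_def max_def)
      moreover have "0 \<le> C * T ^ (n - 1)" using C T by simp
      ultimately show False using big xb yb by auto
    qed
  qed (use C in simp)
qed

lemma hop_mat_det_nonzero:
  assumes n: "n > 0" and r: "bij_betw r {0..<n} {0..<n}" and e: "bij_betw e {0..<n} {0..<n}"
    and cyc: "\<And>t. t < n \<Longrightarrow> p (e t) = r (e (Suc t mod n))" and x: "norm x \<ge> 1"
  obtains y where "y \<noteq> 0" "det (hop_mat n w p p' r r' x y) \<noteq> 0"
proof -
  obtain c1 c2 R where c: "norm c1 = 1" "norm c2 = 1" and R: "tame (n - 1) R"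
    and det: "\<And>x y. det (hop_mat n w p p' r r' x y) = c1 * x ^ n + c2 * y ^ n + R x y"
    using hop_mat_det_asymptotics[OF n r e cyc] by metis
  obtain C where C: "C \<ge> 0"
    and bR: "\<And>x y. 1 \<le> norm x \<Longrightarrow> 1 \<le> norm y \<Longrightarrow> norm (R x y) \<le> C * max (norm x) (norm y) ^ (n - 1)"
    using tameE[OF R] by metis
  \<comment> \<open>One factor \<open>Y\<close> of \<open>Y ^ n\<close> is split into its three
    summands: the first dominates the x-term, the second the remainder, and the third keeps the
    inequality strict.\<close>
  define Y where "Y = norm x ^ n + C + 1"
  have xn: "norm x ^ n \<ge> norm x" using x n self_le_power by blast
  have Y: "Y \<ge> norm x" "Y \<ge> 1" using C xn x by (auto simp: Y_def)
  have Yp: "Y ^ (n - 1) \<ge> 1" using Y by simp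
  show ?thesis
  proof (rule that[of "of_real Y"])
    show "complex_of_real Y \<noteq> 0" using Y by auto
    show "det (hop_mat n w p p' r r' x (of_real Y)) \<noteq> 0"
    proof
      assume "det (hop_mat n w p p' r r' x (of_real Y)) = 0"
      hence "c2 * of_real Y ^ n = - (c1 * x ^ n + R x (of_real Y))"
        unfolding det by (simp add: add_eq_0_iff algebra_simps)
      hence "norm (c2 * of_real Y ^ n) = norm (c1 * x ^ n + R x (of_real Y))"
        by (simp only: norm_minus_cancel)
      hence "Y ^ n = norm (c1 * x ^ n + R x (of_real Y))" using Y by (simp add: norm_mult norm_power c)
      also have "\<dots> \<le> norm x ^ n + C * Y ^ (n - 1)"
        by (rule order.trans[OF norm_triangle_ineq])
           (use bR[OF x, of "of_real Y"] Y c in \<open>simp add: norm_mult norm_power max_absorb2\<close>)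
      finally have "Y ^ n \<le> norm x ^ n + C * Y ^ (n - 1)" .
      moreover have "Y ^ n = norm x ^ n * Y ^ (n - 1) + C * Y ^ (n - 1) + Y ^ (n - 1)"
        using n by (cases n) (simp_all add: Y_def algebra_simps)
      moreover have "norm x ^ n * Y ^ (n - 1) \<ge> norm x ^ n"
        using mult_left_mono[OF Yp, of "norm x ^ n"] by simp
      ultimately show False using Yp by linarith
    qed
  qed
qed

section \<open>The Floquet matrix as a Laurent polynomial\<close>

definition site_index :: "nat \<Rightarrow> nat \<Rightarrow> int \<Rightarrow> int \<Rightarrow> nat" where
  "site_index q1 q2 a b = cell_index q1 (reduce_site q1 q2 (a, b))"

lemma site_index_less:
  assumes "q1 > 0" "q2 > 0"
  shows "site_index q1 q2 a b < q1 * q2"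
proof -
  have a: "nat (a mod int q1) < q1" and b: "nat (b mod int q2) < q2"
    using assms by (auto simp: nat_less_iff)
  have "nat (a mod int q1) + q1 * nat (b mod int q2) < q1 + q1 * nat (b mod int q2)" using a by simp
  also have "\<dots> = q1 * Suc (nat (b mod int q2))" by simp
  also have "\<dots> \<le> q1 * q2" using b by (intro mult_le_mono2) simp
  finally show ?thesis by (simp add: site_index_def cell_index_def reduce_site_def)
qed

lemma cell_site_site_index:
  assumes "q1 > 0" "q2 > 0"
  shows "cell_site q1 (site_index q1 q2 a b) = (a mod int q1, b mod int q2)"
proof -
  have "nat (a mod int q1) < q1" using assms by (auto simp: nat_less_iff)
  thus ?thesis using assms
    by (simp add: cell_site_def site_index_def cell_index_def reduce_site_def)
qed

lemma site_index_eq_iff: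
  assumes "q1 > 0" "q2 > 0"
  shows "site_index q1 q2 a b = site_index q1 q2 c d \<longleftrightarrow>
    a mod int q1 = c mod int q1 \<and> b mod int q2 = d mod int q2"
proof
  assume "site_index q1 q2 a b = site_index q1 q2 c d"
  hence "cell_site q1 (site_index q1 q2 a b) = cell_site q1 (site_index q1 q2 c d)" by simp
  thus "a mod int q1 = c mod int q1 \<and> b mod int q2 = d mod int q2"
    by (simp add: cell_site_site_index[OF assms])
qed (simp add: site_index_def reduce_site_def)

lemma cell_site_bounds:
  assumes "q1 > 0" "i < q1 * q2"
  shows "0 \<le> fst (cell_site q1 i)" "fst (cell_site q1 i) < int q1"
    "0 \<le> snd (cell_site q1 i)" "snd (cell_site q1 i) < int q2"
  using assms by (auto simp: cell_site_def div_less_iff_less_mult mult.commute simp flip: of_nat_mod of_nat_div)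

lemma site_index_cell_site:
  assumes "q1 > 0" "i < q1 * q2"
  shows "site_index q1 q2 (fst (cell_site q1 i)) (snd (cell_site q1 i)) = i"
proof -
  have "i div q1 < q2" using assms by (simp add: div_less_iff_less_mult mult.commute)
  thus ?thesis using assms
    by (simp add: site_index_def cell_site_def cell_index_def reduce_site_def flip: of_nat_mod of_nat_div)
qed

text \<open>The contribution of the single hop by \<open>(a, b)\<close>, with the Floquet phases
  replaced by integer powers of complex z1, z2 that may leave the torus. Hops are kept apart because
  in a cell of side 1 or 2 several of them contribute to the same matrix entry.\<close>

definition hop_entry :: "nat \<Rightarrow> nat \<Rightarrow> complex \<Rightarrow> complex \<Rightarrow> int \<Rightarrow> int \<Rightarrow> nat \<Rightarrow> nat \<Rightarrow> complex" where
  "hop_entry q1 q2 z1 z2 a b i j =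
     (let n1 = fst (cell_site q1 i) + a; n2 = snd (cell_site q1 i) + b in
      if site_index q1 q2 n1 n2 = j then z1 powi (n1 div int q1) * z2 powi (n2 div int q2) else 0)"

definition bloch_matrix ::
  "nat \<Rightarrow> nat \<Rightarrow> (int \<times> int \<Rightarrow> real) \<Rightarrow> complex \<Rightarrow> complex \<Rightarrow> complex mat" where
  "bloch_matrix q1 q2 V z1 z2 = mat (q1 * q2) (q1 * q2) (\<lambda>(i, j).
     (if i = j then complex_of_real (V (cell_site q1 i)) else 0)
     - (hop_entry q1 q2 z1 z2 1 0 i j + hop_entry q1 q2 z1 z2 (-1) 0 i j
        + hop_entry q1 q2 z1 z2 0 1 i j + hop_entry q1 q2 z1 z2 0 (-1) i j))"

lemma bloch_matrix_carrier [simp]: "bloch_matrix q1 q2 V z1 z2 \<in> carrier_mat (q1 * q2) (q1 * q2)"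
  by (simp add: bloch_matrix_def)

lemma floquet_matrix_eq_bloch_matrix:
  "floquet_matrix q1 q2 V k = bloch_matrix q1 q2 V (cis (2 * pi * fst k)) (cis (2 * pi * snd k))"
proof -
  have phase: "floquet_phase q1 q2 k n =
    cis (2 * pi * fst k) powi (fst n div int q1) * cis (2 * pi * snd k) powi (snd n div int q2)" for n
    by (simp add: floquet_phase_def cis_power_int cis_mult algebra_simps)
  show ?thesis
    unfolding floquet_matrix_def bloch_matrix_def
    by (rule eq_matI) (simp_all add: nbrs_def phase hop_entry_def site_index_def Let_def)
qed

text \<open>The reverse hop crosses the same cell boundaries in the opposite direction, so its
  exponents are the negatives; on the unit circle conjugation does the same.\<close>

lemma hop_entry_cnj:
  assumes q: "q1 > 0" "q2 > 0" and ij: "i < q1 * q2" "j < q1 * q2"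
    and z: "norm z1 = 1" "norm z2 = 1"
  shows "cnj (hop_entry q1 q2 z1 z2 a b j i) = hop_entry q1 q2 z1 z2 (- a) (- b) i j"
proof -
  have key: "site_index q1 q2 (fst (cell_site q1 i) - a) (snd (cell_site q1 i) - b) = j \<and>
      (fst (cell_site q1 i) - a) div int q1 = - ((fst (cell_site q1 j) + a) div int q1) \<and>
      (snd (cell_site q1 i) - b) div int q2 = - ((snd (cell_site q1 j) + b) div int q2)"
    if h: "site_index q1 q2 (fst (cell_site q1 j) + a) (snd (cell_site q1 j) + b) = i"
      and ij: "i < q1 * q2" "j < q1 * q2" for i j a b
  proof -
    let ?m1 = "fst (cell_site q1 j)" and ?m2 = "snd (cell_site q1 j)"
    have "cell_site q1 i = ((?m1 + a) mod int q1, (?m2 + b) mod int q2)"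
      using cell_site_site_index[OF q, of "?m1 + a" "?m2 + b"] h by simp
    hence i: "fst (cell_site q1 i) = (?m1 + a) mod int q1" "snd (cell_site q1 i) = (?m2 + b) mod int q2"
      by auto
    have e1: "fst (cell_site q1 i) - a = ?m1 + int q1 * (- ((?m1 + a) div int q1))"
      unfolding i by (simp add: minus_mult_div_eq_mod[symmetric])
    have e2: "snd (cell_site q1 i) - b = ?m2 + int q2 * (- ((?m2 + b) div int q2))"
      unfolding i by (simp add: minus_mult_div_eq_mod[symmetric])
    note bd = cell_site_bounds[OF q(1) ij(2)]
    have "site_index q1 q2 (fst (cell_site q1 i) - a) (snd (cell_site q1 i) - b) = site_index q1 q2 ?m1 ?m2"
      unfolding e1 e2 site_index_eq_iff[OF q] by (simp only: mod_mult_self2 simp_thms)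
    hence "site_index q1 q2 (fst (cell_site q1 i) - a) (snd (cell_site q1 i) - b) = j"
      using site_index_cell_site[OF q(1) ij(2)] by simp
    moreover have "(fst (cell_site q1 i) - a) div int q1 = - ((?m1 + a) div int q1)"
      unfolding e1 by (subst div_mult_self2) (use bd q in auto)
    moreover have "(snd (cell_site q1 i) - b) div int q2 = - ((?m2 + b) div int q2)"
      unfolding e2 by (subst div_mult_self2) (use bd q in auto)
    ultimately show ?thesis by blast
  qed
  have inv: "cnj z = inverse z" if "norm z = 1" for z
    using that by (metis complex_norm_square inverse_unique of_real_1 one_power2)
  have cnj_powi: "cnj z powi m = z powi (- m)" if "norm z = 1" for z m
    using inv[OF that] by (simp add: power_int_minus power_int_inverse)
  show ?thesis
  proof (cases "site_index q1 q2 (fst (cell_site q1 j) + a) (snd (cell_site q1 j) + b) = i")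
    case True
    from key[OF True ij] show ?thesis using True z
      by (simp add: hop_entry_def Let_def cnj_powi)
  next
    case False
    hence "site_index q1 q2 (fst (cell_site q1 i) + - a) (snd (cell_site q1 i) + - b) \<noteq> j"
      using key[of i "- a" "- b" j] ij by auto
    with False show ?thesis by (simp add: hop_entry_def Let_def)
  qed
qed

lemma bloch_matrix_hermitian:
  assumes q: "q1 > 0" "q2 > 0" and z: "norm z1 = 1" "norm z2 = 1"
  shows "ctranspose (bloch_matrix q1 q2 V z1 z2) = bloch_matrix q1 q2 V z1 z2"
  unfolding ctranspose_eq_iff[OF bloch_matrix_carrier]
  by (auto simp: bloch_matrix_def hop_entry_cnj[OF q _ _ z])

text \<open>The gauge factor of a site (n1, n2) is x^n1 y^n2. Since q (n div q) + n mod q = n, the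
  phases collected at the cell boundary become one power of \<open>x\<close> or \<open>y\<close> per
  unit step, independent of the site.\<close>

lemma hop_entry_gauge:
  assumes q: "q1 > 0" "q2 > 0" and xy: "x \<noteq> 0" "y \<noteq> 0"
  defines "g \<equiv> \<lambda>i. x powi fst (cell_site q1 i) * y powi snd (cell_site q1 i)"
  shows "inverse (g i) * hop_entry q1 q2 (x ^ q1) (y ^ q2) a b i j * g j =
    (if site_index q1 q2 (fst (cell_site q1 i) + a) (snd (cell_site q1 i) + b) = j
     then x powi a * y powi b else 0)"
proof (cases "site_index q1 q2 (fst (cell_site q1 i) + a) (snd (cell_site q1 i) + b) = j")
  case True
  let ?n1 = "fst (cell_site q1 i)" and ?n2 = "snd (cell_site q1 i)"
  have j: "cell_site q1 j = ((?n1 + a) mod int q1, (?n2 + b) mod int q2)"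
    using cell_site_site_index[OF q, of "?n1 + a" "?n2 + b"] True by simp
  have w: "(w ^ k) powi (m div int k) * w powi (m mod int k) = w powi m" if "w \<noteq> 0" for w :: complex and k m
  proof -
    have "(w ^ k) powi (m div int k) * w powi (m mod int k) = w powi (int k * (m div int k) + m mod int k)"
      by (subst power_int_add) (use that in \<open>auto simp: power_int_mult\<close>)
    thus ?thesis by (simp only: mult_div_mod_eq)
  qed
  have "hop_entry q1 q2 (x ^ q1) (y ^ q2) a b i j * g j =
      ((x ^ q1) powi ((?n1 + a) div int q1) * x powi ((?n1 + a) mod int q1)) *
      ((y ^ q2) powi ((?n2 + b) div int q2) * y powi ((?n2 + b) mod int q2))"
    using True by (simp add: hop_entry_def Let_def g_def j mult_ac)
  also have "\<dots> = g i * (x powi a * y powi b)"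
    unfolding w[OF xy(1)] w[OF xy(2)] using xy by (simp add: g_def power_int_add mult_ac)
  finally have "hop_entry q1 q2 (x ^ q1) (y ^ q2) a b i j * g j = g i * (x powi a * y powi b)" .
  moreover have "g i \<noteq> 0" using xy by (simp add: g_def)
  ultimately show ?thesis using True by (simp add: mult.assoc)
qed (simp add: hop_entry_def Let_def)

lemma det_scale_rows_cols:
  fixes M :: "'a :: comm_ring_1 mat"
  assumes M: "M \<in> carrier_mat n n"
  shows "det (mat n n (\<lambda>(i, j). a i * M $$ (i, j) * b j)) = prod a {0..<n} * prod b {0..<n} * det M"
proof -
  have "det (mat n n (\<lambda>(i, j). a i * M $$ (i, j) * b j)) =
    (\<Sum>p | p permutes {0..<n}. signof p * (\<Prod>i = 0..<n. a i * M $$ (i, p i) * b (p i)))"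
  proof (subst det_def'[of _ n], simp, rule sum.cong[OF refl])
    fix p assume "p \<in> {p. p permutes {0..<n}}"
    hence p: "p permutes {0..<n}" by simp
    hence pn: "p i < n" if "i < n" for i using permutes_in_image[OF p, of i] that by simp
    show "signof p * (\<Prod>i = 0..<n. mat n n (\<lambda>(i, j). a i * M $$ (i, j) * b j) $$ (i, p i)) =
        signof p * (\<Prod>i = 0..<n. a i * M $$ (i, p i) * b (p i))"
      by (intro arg_cong2[of _ _ _ _ "(*)"] prod.cong) (use pn in auto)
  qed
  also have "\<dots> = (\<Sum>p | p permutes {0..<n}. prod a {0..<n} * prod b {0..<n} * (signof p * (\<Prod>i = 0..<n. M $$ (i, p i))))"
  proof (rule sum.cong[OF refl])
    fix p assume "p \<in> {p. p permutes {0..<n}}"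
    hence "(\<Prod>i = 0..<n. b (p i)) = prod b {0..<n}"
      using prod.permute[of p "{0..<n}" b] by (simp add: o_def)
    thus "signof p * (\<Prod>i = 0..<n. a i * M $$ (i, p i) * b (p i)) =
        prod a {0..<n} * prod b {0..<n} * (signof p * (\<Prod>i = 0..<n. M $$ (i, p i)))"
      by (simp add: prod.distrib mult_ac)
  qed
  finally show ?thesis by (simp add: det_def'[OF M] sum_distrib_left)
qed

definition nbr :: "nat \<Rightarrow> nat \<Rightarrow> int \<Rightarrow> int \<Rightarrow> nat \<Rightarrow> nat" where
  "nbr q1 q2 a b i = site_index q1 q2 (fst (cell_site q1 i) + a) (snd (cell_site q1 i) + b)"

text \<open>In \<open>t\<close> minus the matrix the hops of the negative Laplacian appear with a
  plus sign, as \<open>hop_mat\<close> expects.\<close>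

lemma poly_char_poly_bloch_matrix:
  "poly (char_poly (bloch_matrix q1 q2 V z1 z2)) t = det (mat (q1 * q2) (q1 * q2) (\<lambda>(i, j).
     (if i = j then t - of_real (V (cell_site q1 i)) else 0)
     + (hop_entry q1 q2 z1 z2 1 0 i j + hop_entry q1 q2 z1 z2 (-1) 0 i j
        + hop_entry q1 q2 z1 z2 0 1 i j + hop_entry q1 q2 z1 z2 0 (-1) i j)))"
  unfolding char_poly_def
  by (rule poly_det_cong[of _ "q1 * q2"]) (auto simp: char_poly_matrix_def bloch_matrix_def)

lemma poly_char_poly_bloch_matrix_gauge:
  assumes q: "q1 > 0" "q2 > 0" and xy: "x \<noteq> 0" "y \<noteq> 0"
  shows "poly (char_poly (bloch_matrix q1 q2 V (x ^ q1) (y ^ q2))) t =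
    det (hop_mat (q1 * q2) (\<lambda>i. t - of_real (V (cell_site q1 i)))
      (nbr q1 q2 1 0) (nbr q1 q2 (-1) 0) (nbr q1 q2 0 1) (nbr q1 q2 0 (-1)) x y)"
proof -
  define g where "g i = x powi fst (cell_site q1 i) * y powi snd (cell_site q1 i)" for i
  have g0: "g i \<noteq> 0" for i using xy by (simp add: g_def)
  let ?n = "q1 * q2" and ?h = "hop_entry q1 q2 (x ^ q1) (y ^ q2)"
  let ?L = "mat ?n ?n (\<lambda>(i, j). (if i = j then t - of_real (V (cell_site q1 i)) else 0)
     + (?h 1 0 i j + ?h (-1) 0 i j + ?h 0 1 i j + ?h 0 (-1) i j))"
  let ?H = "hop_mat ?n (\<lambda>i. t - of_real (V (cell_site q1 i)))
      (nbr q1 q2 1 0) (nbr q1 q2 (-1) 0) (nbr q1 q2 0 1) (nbr q1 q2 0 (-1)) x y"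
  note gauge = hop_entry_gauge[OF q xy, folded g_def nbr_def]
  have "?H = mat ?n ?n (\<lambda>(i, j). inverse (g i) * ?L $$ (i, j) * g j)"
  proof (rule eq_matI, goal_cases)
    case (1 i j)
    hence ij: "i < ?n" "j < ?n" by auto
    have "inverse (g i) * ?L $$ (i, j) * g j = inverse (g i) * (if i = j then t - of_real (V (cell_site q1 i)) else 0) * g j
      + (inverse (g i) * ?h 1 0 i j * g j + inverse (g i) * ?h (-1) 0 i j * g j
        + inverse (g i) * ?h 0 1 i j * g j + inverse (g i) * ?h 0 (-1) i j * g j)"
      using ij by (simp add: distrib_left distrib_right)
    also have "\<dots> = ?H $$ (i, j)"
      unfolding gauge using ij g0 by (auto simp: hop_mat_def power_int_minus)
    finally show ?case using ij by simp
  qed (auto simp: hop_mat_def)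
  hence "det ?H = (\<Prod>i = 0..<?n. inverse (g i)) * prod g {0..<?n} * det ?L"
    by (simp only: det_scale_rows_cols[of ?L ?n] mat_carrier)
  also have "(\<Prod>i = 0..<?n. inverse (g i)) * prod g {0..<?n} = 1"
    using g0 by (simp add: prod.distrib[symmetric])
  finally show ?thesis unfolding poly_char_poly_bloch_matrix by simp
qed

lemma bij_betw_nbr:
  assumes q: "q1 > 0" "q2 > 0"
  shows "bij_betw (nbr q1 q2 a b) {0..<q1 * q2} {0..<q1 * q2}"
proof -
  have sub: "nbr q1 q2 a b ` {0..<q1 * q2} \<subseteq> {0..<q1 * q2}"
    using site_index_less[OF q] by (auto simp: nbr_def)
  have "inj_on (nbr q1 q2 a b) {0..<q1 * q2}"
  proof (rule inj_onI)
    fix i j assume ij: "i \<in> {0..<q1 * q2}" "j \<in> {0..<q1 * q2}" and eq: "nbr q1 q2 a b i = nbr q1 q2 a b j"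
    from ij have ij: "i < q1 * q2" "j < q1 * q2" by auto
    from eq have "(fst (cell_site q1 i) + a) mod int q1 = (fst (cell_site q1 j) + a) mod int q1"
      "(snd (cell_site q1 i) + b) mod int q2 = (snd (cell_site q1 j) + b) mod int q2"
      by (auto simp: nbr_def site_index_eq_iff[OF q])
    hence "fst (cell_site q1 i) mod int q1 = fst (cell_site q1 j) mod int q1"
      "snd (cell_site q1 i) mod int q2 = snd (cell_site q1 j) mod int q2"
      by (metis add_diff_cancel_right' mod_diff_left_eq)+
    hence "cell_site q1 i = cell_site q1 j"
      using cell_site_bounds[OF q(1) ij(1)] cell_site_bounds[OF q(1) ij(2)] by (simp add: prod_eq_iff)
    thus "i = j" using site_index_cell_site[OF q(1) ij(1)] site_index_cell_site[OF q(1) ij(2)] by metis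
  qed
  thus ?thesis using sub by (simp add: bij_betw_def endo_inj_surj)
qed

text \<open>The point number \<open>t\<close> is (t, -s t) modulo (q1, q2); by the Chinese remainder
  theorem these points exhaust the cell. A step by (1, 0) from point \<open>t\<close> and a step by
  (0, s) from point \<open>t + 1\<close> both end at (t + 1, -s t), so the enumeration is the
  required single cycle. The sign \<open>s\<close> = -1 serves the regime of small
  \<open>y\<close>.\<close>

lemma diagonal_enumeration:
  assumes q: "q1 > 0" "q2 > 0" "coprime q1 q2" and s: "s = 1 \<or> s = -1"
  obtains e where "bij_betw e {0..<q1 * q2} {0..<q1 * q2}"
    "\<And>t. t < q1 * q2 \<Longrightarrow> nbr q1 q2 1 0 (e t) = nbr q1 q2 0 s (e (Suc t mod (q1 * q2)))"
proof -
  define e where "e t = site_index q1 q2 (int t) (- s * int t)" for t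
  let ?n = "q1 * q2"
  have sub: "e ` {0..<?n} \<subseteq> {0..<?n}" using site_index_less[OF q(1,2)] by (auto simp: e_def)
  have "inj_on e {0..<?n}"
  proof (rule inj_onI)
    fix t u assume tu: "t \<in> {0..<?n}" "u \<in> {0..<?n}" and "e t = e u"
    hence "int t mod int q1 = int u mod int q1" "(- s * int t) mod int q2 = (- s * int u) mod int q2"
      by (auto simp: e_def site_index_eq_iff[OF q(1,2)])
    hence "int q1 dvd int t - int u" "int q2 dvd (- s * int t) - (- s * int u)"
      by (auto simp: mod_eq_dvd_iff)
    moreover have "(- s * int t) - (- s * int u) = - s * (int t - int u)" by (simp add: algebra_simps)
    ultimately have "int q1 dvd int t - int u" "int q2 dvd int t - int u" using s by auto
    hence "int q1 * int q2 dvd int t - int u"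
      using q(3) by (intro divides_mult) auto
    hence "int t mod int ?n = int u mod int ?n" by (simp add: mod_eq_dvd_iff)
    hence "int (t mod ?n) = int (u mod ?n)" by (simp only: of_nat_mod)
    thus "t = u" using tu by simp
  qed
  hence "bij_betw e {0..<?n} {0..<?n}" using sub by (simp add: bij_betw_def endo_inj_surj)
  moreover have "nbr q1 q2 1 0 (e t) = nbr q1 q2 0 s (e (Suc t mod ?n))" for t
  proof -
    have nbr_e: "nbr q1 q2 a b (e t) = site_index q1 q2 (int t + a) (- s * int t + b)" for a b t
      by (simp add: nbr_def e_def cell_site_site_index[OF q(1,2)] site_index_eq_iff[OF q(1,2)] mod_simps)
    have m1: "int (Suc t mod ?n) mod int q1 = (int t + 1) mod int q1"
      by (simp add: of_nat_mod mod_mod_cancel add.commute)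
    have m2: "int (Suc t mod ?n) mod int q2 = (int t + 1) mod int q2"
      by (simp add: of_nat_mod mod_mod_cancel add.commute)
    have "int q2 dvd int (Suc t mod ?n) - (int t + 1)" using m2 unfolding mod_eq_dvd_iff .
    hence "int q2 dvd - s * (int (Suc t mod ?n) - (int t + 1))" by (rule dvd_mult)
    also have "- s * (int (Suc t mod ?n) - (int t + 1)) = (- s * int (Suc t mod ?n) + s) - (- s * int t)"
      by (simp add: algebra_simps)
    finally have "(- s * int (Suc t mod ?n) + s) mod int q2 = (- s * int t) mod int q2"
      unfolding mod_eq_dvd_iff .
    thus ?thesis unfolding nbr_e site_index_eq_iff[OF q(1,2)] using m1 by simp
  qed
  ultimately show ?thesis by (rule that)
qed

section \<open>Clearing denominators, with degree bounds in z1 and z2\<close>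

definition inner_degree_le :: "nat \<Rightarrow> complex poly poly \<Rightarrow> bool" where
  "inner_degree_le d f \<longleftrightarrow> (\<forall>k. degree (coeff f k) \<le> d)"

lemma inner_degree_le_mult:
  assumes "inner_degree_le d f" "inner_degree_le e g"
  shows "inner_degree_le (d + e) (f * g)"
  unfolding inner_degree_le_def
proof
  fix k
  show "degree (coeff (f * g) k) \<le> d + e"
    unfolding coeff_mult
    by (rule degree_sum_le)
       (use assms in \<open>auto simp: inner_degree_le_def intro!: order.trans[OF degree_mult_le] add_mono\<close>)
qed

lemma inner_degree_le_sum:
  assumes "\<And>i. i \<in> I \<Longrightarrow> inner_degree_le d (f i)"
  shows "inner_degree_le d (\<Sum>i\<in>I. f i)"
  using assms
  by (induction I rule: infinite_finite_induct)
     (auto simp: inner_degree_le_def intro!: degree_add_le)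

lemma inner_degree_le_prod:
  assumes "\<And>i. i \<in> I \<Longrightarrow> inner_degree_le (d i) (f i)"
  shows "inner_degree_le (\<Sum>i\<in>I. d i) (\<Prod>i\<in>I. f i)"
  using assms
  by (induction I rule: infinite_finite_induct)
     (auto simp: inner_degree_le_def[of 0] coeff_1 intro!: inner_degree_le_mult)

lemma inner_degree_le_det:
  assumes M: "M \<in> carrier_mat n n"
    and d: "\<And>i j. i < n \<Longrightarrow> j < n \<Longrightarrow> inner_degree_le (d i) (M $$ (i, j))"
  shows "inner_degree_le (\<Sum>i = 0..<n. d i) (det M)"
  unfolding det_def'[OF M]
proof (rule inner_degree_le_sum, clarify)
  fix p assume p: "p permutes {0..<n}"
  hence pn: "p i < n" if "i < n" for i using permutes_in_image[OF p, of i] that by simp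
  have "inner_degree_le 0 (signof p)"
    by (auto simp: inner_degree_le_def sign_def coeff_1)
  from inner_degree_le_mult[OF this inner_degree_le_prod[of "{0..<n}" d "\<lambda>i. M $$ (i, p i)"]]
  show "inner_degree_le (\<Sum>i = 0..<n. d i) (signof p * (\<Prod>i = 0..<n. M $$ (i, p i)))"
    using d pn by simp
qed

lemma degree_det_le_sum_rows:
  fixes M :: "'a :: comm_ring_1 poly mat"
  assumes M: "M \<in> carrier_mat n n"
    and d: "\<And>i j. i < n \<Longrightarrow> j < n \<Longrightarrow> degree (M $$ (i, j)) \<le> d i"
  shows "degree (det M) \<le> (\<Sum>i = 0..<n. d i)"
  unfolding det_def'[OF M]
proof (rule degree_sum_le)
  fix p assume "p \<in> {p. p permutes {0..<n}}"
  hence p: "p permutes {0..<n}" by simp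
  hence pn: "p i < n" if "i < n" for i using permutes_in_image[OF p, of i] that by simp
  have "degree (signof p * (\<Prod>i = 0..<n. M $$ (i, p i))) = degree (\<Prod>i = 0..<n. M $$ (i, p i))"
    by (rule degree_signof_mult)
  also have "\<dots> \<le> (\<Sum>i = 0..<n. degree (M $$ (i, p i)))"
    using degree_prod_sum_le[of "{0..<n}" "\<lambda>i. M $$ (i, p i)"] by (simp add: o_def)
  also have "\<dots> \<le> (\<Sum>i = 0..<n. d i)" by (rule sum_mono) (use d pn in auto)
  finally show "degree (signof p * (\<Prod>i = 0..<n. M $$ (i, p i))) \<le> (\<Sum>i = 0..<n. d i)" .
qed (simp add: finite_permutations)

text \<open>A hop of length at most 1 leaves the cell only from a boundary site, and by a single
  cell. The indicator form of the bounds lets the exponents be summed over all rows; for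
  \<open>q\<close> = 1 a site lies on both boundaries.\<close>

lemma neighbour_div_bounds:
  fixes n a :: int
  assumes "0 \<le> n" "n < int q" "\<bar>a\<bar> \<le> 1"
  shows "- of_bool (n = 0) \<le> (n + a) div int q" "(n + a) div int q \<le> of_bool (n = int q - 1)"
proof -
  consider "n + a = -1" "n = 0" | "0 \<le> n + a" "n + a < int q" | "n + a = int q" "n = int q - 1"
    using assms by (cases "n + a < 0"; cases "n + a < int q") auto
  hence "- of_bool (n = 0) \<le> (n + a) div int q \<and> (n + a) div int q \<le> of_bool (n = int q - 1)"
  proof cases
    case 1
    have "(- 1) div int q = - 1" using assms by (simp add: div_eq_minus1)
    thus ?thesis using 1 by simp
  next
    case 2
    thus ?thesis by simp
  next
    case 3
    thus ?thesis using assms by simp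
  qed
  thus "- of_bool (n = 0) \<le> (n + a) div int q" "(n + a) div int q \<le> of_bool (n = int q - 1)" by auto
qed

text \<open>Row \<open>i\<close> is multiplied by \<open>z1\<close> and/or \<open>z2\<close> if the site lies on the lower boundary of the cell, where
  hopping produces negative powers.\<close>

definition lower_bd :: "int \<Rightarrow> nat" where
  "lower_bd n = of_bool (n = 0)"

definition hop_poly :: "nat \<Rightarrow> nat \<Rightarrow> int \<Rightarrow> int \<Rightarrow> nat \<Rightarrow> nat \<Rightarrow> complex poly poly" where
  "hop_poly q1 q2 a b i j = (let n1 = fst (cell_site q1 i); n2 = snd (cell_site q1 i) in
     if nbr q1 q2 a b i = j
     then monom (monom 1 (nat (int (lower_bd n1) + (n1 + a) div int q1))) (nat (int (lower_bd n2) + (n2 + b) div int q2))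
     else 0)"

definition bloch_poly_matrix ::
  "nat \<Rightarrow> nat \<Rightarrow> (int \<times> int \<Rightarrow> real) \<Rightarrow> complex \<Rightarrow> complex poly poly mat" where
  "bloch_poly_matrix q1 q2 V t = mat (q1 * q2) (q1 * q2) (\<lambda>(i, j).
     (if i = j then monom (monom (t - of_real (V (cell_site q1 i))) (lower_bd (fst (cell_site q1 i))))
        (lower_bd (snd (cell_site q1 i))) else 0)
     + (hop_poly q1 q2 1 0 i j + hop_poly q1 q2 (-1) 0 i j + hop_poly q1 q2 0 1 i j + hop_poly q1 q2 0 (-1) i j))"

definition bloch_poly :: "nat \<Rightarrow> nat \<Rightarrow> (int \<times> int \<Rightarrow> real) \<Rightarrow> complex \<Rightarrow> complex poly poly" where
  "bloch_poly q1 q2 V t = det (bloch_poly_matrix q1 q2 V t)"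

lemma poly_at_monom: "poly_at a (monom c k) = monom (poly c a) k"
  by (rule poly_eqI) (simp add: coeff_poly_at)

lemma power_nat_add_eq_powi:
  fixes z :: "'a :: field"
  assumes "z \<noteq> 0" "0 \<le> int l + m"
  shows "z ^ nat (int l + m) = z ^ l * z powi m"
proof -
  have "z ^ nat (int l + m) = z powi (int l + m)" using assms by (simp add: power_int_def)
  also have "\<dots> = z ^ l * z powi m" using assms by (simp add: power_int_add)
  finally show ?thesis .
qed

lemma poly_hop_poly:
  assumes q: "q1 > 0" and i: "i < q1 * q2" and ab: "\<bar>a\<bar> \<le> 1" "\<bar>b\<bar> \<le> 1" and z: "z1 \<noteq> 0" "z2 \<noteq> 0"
  shows "poly (poly_at z1 (hop_poly q1 q2 a b i j)) z2 =
    z1 ^ lower_bd (fst (cell_site q1 i)) * z2 ^ lower_bd (snd (cell_site q1 i)) * hop_entry q1 q2 z1 z2 a b i j"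
proof -
  note bd = cell_site_bounds[OF q i]
  have "0 \<le> int (lower_bd (fst (cell_site q1 i))) + (fst (cell_site q1 i) + a) div int q1"
    "0 \<le> int (lower_bd (snd (cell_site q1 i))) + (snd (cell_site q1 i) + b) div int q2"
    using neighbour_div_bounds(1)[OF bd(1,2) ab(1)] neighbour_div_bounds(1)[OF bd(3,4) ab(2)]
    by (auto simp: lower_bd_def)
  thus ?thesis using z
    by (simp add: hop_poly_def hop_entry_def nbr_def Let_def poly_at_monom poly_monom power_nat_add_eq_powi mult_ac)
qed

text \<open>The monomial in front is the product of the row factors. It has no zeros for nonzero z1,
  z2, so zeros and double zeros there are unaffected by clearing denominators.\<close>

lemma poly_bloch_poly:
  assumes q: "q1 > 0" and z: "z1 \<noteq> 0" "z2 \<noteq> 0"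
  shows "poly (poly_at z1 (bloch_poly q1 q2 V t)) z2 =
    z1 ^ (\<Sum>i = 0..<q1 * q2. lower_bd (fst (cell_site q1 i))) *
    z2 ^ (\<Sum>i = 0..<q1 * q2. lower_bd (snd (cell_site q1 i))) *
    poly (char_poly (bloch_matrix q1 q2 V z1 z2)) t"
proof -
  let ?n = "q1 * q2" and ?M = "bloch_poly_matrix q1 q2 V t" and ?h = "hop_entry q1 q2 z1 z2"
  let ?L = "mat ?n ?n (\<lambda>(i, j). (if i = j then t - of_real (V (cell_site q1 i)) else 0)
     + (?h 1 0 i j + ?h (-1) 0 i j + ?h 0 1 i j + ?h 0 (-1) i j))"
  let ?s = "\<lambda>i. z1 ^ lower_bd (fst (cell_site q1 i)) * z2 ^ lower_bd (snd (cell_site q1 i))"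
  have "poly (poly_at z1 (bloch_poly q1 q2 V t)) z2 = poly (det (map_mat (poly_at z1) ?M)) z2"
    unfolding bloch_poly_def poly_at_hom.hom_det ..
  also have "\<dots> = det (mat ?n ?n (\<lambda>(i, j). ?s i * ?L $$ (i, j) * 1))"
  proof (rule poly_det_cong[of _ ?n])
    fix i j assume ij: "i < ?n" "j < ?n"
    have "poly (map_mat (poly_at z1) ?M $$ (i, j)) z2 =
      (if i = j then ?s i * (t - of_real (V (cell_site q1 i))) else 0)
      + (?s i * ?h 1 0 i j + ?s i * ?h (-1) 0 i j + ?s i * ?h 0 1 i j + ?s i * ?h 0 (-1) i j)"
      using ij z by (simp add: bloch_poly_matrix_def poly_at_hom.hom_add poly_hop_poly[OF q ij(1)] poly_at_monom poly_monom mult_ac)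
    also have "\<dots> = ?s i * ?L $$ (i, j)" using ij by (auto simp: distrib_left)
    finally show "poly (map_mat (poly_at z1) ?M $$ (i, j)) z2 = mat ?n ?n (\<lambda>(i, j). ?s i * ?L $$ (i, j) * 1) $$ (i, j)"
      using ij by simp
  qed (auto simp: bloch_poly_matrix_def)
  also have "\<dots> = prod ?s {0..<?n} * det ?L"
    by (subst det_scale_rows_cols) simp_all
  also have "prod ?s {0..<?n} = z1 ^ (\<Sum>i = 0..<?n. lower_bd (fst (cell_site q1 i))) *
      z2 ^ (\<Sum>i = 0..<?n. lower_bd (snd (cell_site q1 i)))"
    by (simp add: prod.distrib power_sum)
  finally show ?thesis unfolding poly_char_poly_bloch_matrix .
qed

text \<open>A line of fixed first coordinate contains at most \<open>q2\<close> sites of the cell,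
  one of fixed second coordinate at most \<open>q1\<close>.\<close>

lemma sum_boundary_le:
  assumes q: "q1 > 0"
  shows "(\<Sum>i = 0..<q1 * q2. of_bool (fst (cell_site q1 i) = c)) \<le> q2"
    and "(\<Sum>i = 0..<q1 * q2. of_bool (snd (cell_site q1 i) = c)) \<le> q1"
proof -
  have "{i \<in> {0..<q1 * q2}. fst (cell_site q1 i) = c} \<subseteq> (\<lambda>b. nat c + q1 * b) ` {0..<q2}"
  proof
    fix i assume i: "i \<in> {i \<in> {0..<q1 * q2}. fst (cell_site q1 i) = c}"
    hence "i = nat c + q1 * (i div q1)" "i div q1 < q2"
      using q by (auto simp: cell_site_def div_less_iff_less_mult mult.commute nat_int)
    thus "i \<in> (\<lambda>b. nat c + q1 * b) ` {0..<q2}" by auto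
  qed
  from card_mono[OF _ this] have "card {i \<in> {0..<q1 * q2}. fst (cell_site q1 i) = c} \<le> q2"
    using card_image_le[of "{0..<q2}" "\<lambda>b. nat c + q1 * b"] by simp
  thus "(\<Sum>i = 0..<q1 * q2. of_bool (fst (cell_site q1 i) = c)) \<le> q2"
    by (simp add: of_bool_def sum.If_cases Int_def)
  have "{i \<in> {0..<q1 * q2}. snd (cell_site q1 i) = c} \<subseteq> (\<lambda>a. a + q1 * nat c) ` {0..<q1}"
  proof
    fix i assume i: "i \<in> {i \<in> {0..<q1 * q2}. snd (cell_site q1 i) = c}"
    hence "i = i mod q1 + q1 * nat c" "i mod q1 < q1"
      using q by (auto simp: cell_site_def nat_int)
    thus "i \<in> (\<lambda>a. a + q1 * nat c) ` {0..<q1}" by auto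
  qed
  from card_mono[OF _ this] have "card {i \<in> {0..<q1 * q2}. snd (cell_site q1 i) = c} \<le> q1"
    using card_image_le[of "{0..<q1}" "\<lambda>a. a + q1 * nat c"] by simp
  thus "(\<Sum>i = 0..<q1 * q2. of_bool (snd (cell_site q1 i) = c)) \<le> q1"
    by (simp add: of_bool_def sum.If_cases Int_def)
qed

text \<open>A row gains one degree in z1 if its site is on the lower boundary, through the row
  factor, and one if it is on the upper boundary, through the hop leaving the cell;
  \<open>d1\<close> counts both and \<open>d2\<close> does so for z2. Each of the two boundaries has
  at most \<open>q2\<close>, respectively \<open>q1\<close>, sites.\<close>

lemma bloch_poly_degrees:
  assumes q: "q1 > 0"
  shows "degree (bloch_poly q1 q2 V t) \<le> 2 * q1" "degree (coeff (bloch_poly q1 q2 V t) k) \<le> 2 * q2"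
proof -
  let ?n = "q1 * q2"
  define d1 where "d1 i = of_bool (fst (cell_site q1 i) = 0) + (of_bool (fst (cell_site q1 i) = int q1 - 1) :: nat)" for i
  define d2 where "d2 i = of_bool (snd (cell_site q1 i) = 0) + (of_bool (snd (cell_site q1 i) = int q2 - 1) :: nat)" for i
  have hop: "degree (hop_poly q1 q2 a b i j) \<le> d2 i" "inner_degree_le (d1 i) (hop_poly q1 q2 a b i j)"
    if i: "i < ?n" and ab: "\<bar>a\<bar> \<le> 1" "\<bar>b\<bar> \<le> 1" for a b i j
  proof -
    note bd = cell_site_bounds[OF q i]
    have "nat (int (lower_bd (fst (cell_site q1 i))) + (fst (cell_site q1 i) + a) div int q1) \<le> d1 i"
      unfolding nat_le_iff lower_bd_def d1_def of_nat_add of_nat_of_bool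
      using neighbour_div_bounds(2)[OF bd(1,2) ab(1)] by (rule add_left_mono)
    moreover have "nat (int (lower_bd (snd (cell_site q1 i))) + (snd (cell_site q1 i) + b) div int q2) \<le> d2 i"
      unfolding nat_le_iff lower_bd_def d2_def of_nat_add of_nat_of_bool
      using neighbour_div_bounds(2)[OF bd(3,4) ab(2)] by (rule add_left_mono)
    ultimately show "degree (hop_poly q1 q2 a b i j) \<le> d2 i" "inner_degree_le (d1 i) (hop_poly q1 q2 a b i j)"
      by (auto simp: hop_poly_def Let_def inner_degree_le_def intro: order.trans[OF degree_monom_le])
  qed
  have diag: "degree (monom (monom c (lower_bd (fst (cell_site q1 i)))) (lower_bd (snd (cell_site q1 i)))) \<le> d2 i"
    "inner_degree_le (d1 i) (monom (monom c (lower_bd (fst (cell_site q1 i)))) (lower_bd (snd (cell_site q1 i))))"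
    for c :: complex and i
    by (auto simp: inner_degree_le_def lower_bd_def d1_def d2_def monom_0 intro!: order.trans[OF degree_monom_le])
  have inner_add: "inner_degree_le d (f + g)" if "inner_degree_le d f" "inner_degree_le d g" for d f g
    using that by (auto simp: inner_degree_le_def intro: degree_add_le)
  have M: "bloch_poly_matrix q1 q2 V t \<in> carrier_mat ?n ?n" by (simp add: bloch_poly_matrix_def)
  have "degree (bloch_poly_matrix q1 q2 V t $$ (i, j)) \<le> d2 i" if "i < ?n" "j < ?n" for i j
    using that hop(1)[OF that(1)] diag(1)
    by (auto simp: bloch_poly_matrix_def intro!: degree_add_le)
  hence "degree (bloch_poly q1 q2 V t) \<le> (\<Sum>i = 0..<?n. d2 i)"
    unfolding bloch_poly_def by (rule degree_det_le_sum_rows[OF M])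
  also have "\<dots> \<le> 2 * q1"
    using sum_boundary_le(2)[OF q, of 0 q2] sum_boundary_le(2)[OF q, of "int q2 - 1" q2]
    unfolding d2_def sum.distrib by linarith
  finally show "degree (bloch_poly q1 q2 V t) \<le> 2 * q1" .
  have "inner_degree_le (d1 i) (bloch_poly_matrix q1 q2 V t $$ (i, j))" if "i < ?n" "j < ?n" for i j
    using that hop(2)[OF that(1)] diag(2)
    by (auto simp: bloch_poly_matrix_def intro!: inner_add)
  hence "inner_degree_le (\<Sum>i = 0..<?n. d1 i) (bloch_poly q1 q2 V t)"
    unfolding bloch_poly_def by (rule inner_degree_le_det[OF M])
  hence "degree (coeff (bloch_poly q1 q2 V t) k) \<le> (\<Sum>i = 0..<?n. d1 i)"
    by (simp add: inner_degree_le_def)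
  also have "\<dots> \<le> 2 * q2"
    using sum_boundary_le(1)[OF q, of 0 q2] sum_boundary_le(1)[OF q, of "int q1 - 1" q2]
    unfolding d1_def sum.distrib by linarith
  finally show "degree (coeff (bloch_poly q1 q2 V t) k) \<le> 2 * q2" .
qed

lemma norm_root_ge:
  fixes x :: complex
  assumes "norm (x ^ n) \<ge> r ^ n" "r \<ge> 0" "n > 0"
  shows "norm x \<ge> r"
proof (rule ccontr)
  assume "\<not> norm x \<ge> r"
  hence "norm x ^ n < r ^ n" using assms by (intro power_strict_mono) auto
  thus False using assms(1) by (simp add: norm_power)
qed

text \<open>Excludes that the zero set contains a whole fibre over a point of the unit circle, which
  would make the count infinite.\<close>

lemma bloch_poly_at_nonzero:
  assumes q: "q1 > 0" "q2 > 0" "coprime q1 q2" and a: "norm a = 1"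
  shows "poly_at a (bloch_poly q1 q2 V t) \<noteq> 0"
proof
  assume zero: "poly_at a (bloch_poly q1 q2 V t) = 0"
  obtain x where x: "x ^ q1 = a" using nth_root_exists[OF q(1)] by blast
  hence nx: "norm x \<ge> 1" using norm_root_ge[of 1 q1 x] a q by simp
  obtain e where e: "bij_betw e {0..<q1 * q2} {0..<q1 * q2}"
    "\<And>u. u < q1 * q2 \<Longrightarrow> nbr q1 q2 1 0 (e u) = nbr q1 q2 0 1 (e (Suc u mod (q1 * q2)))"
    using diagonal_enumeration[OF q, of 1] by auto
  have n0: "q1 * q2 > 0" using q by simp
  obtain y where y: "y \<noteq> 0" "det (hop_mat (q1 * q2) (\<lambda>i. t - of_real (V (cell_site q1 i)))
      (nbr q1 q2 1 0) (nbr q1 q2 (-1) 0) (nbr q1 q2 0 1) (nbr q1 q2 0 (-1)) x y) \<noteq> 0"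
    by (rule hop_mat_det_nonzero[OF n0 bij_betw_nbr[OF q(1,2)] e nx])
  have x0: "x \<noteq> 0" using nx by auto
  have "poly (poly_at (x ^ q1) (bloch_poly q1 q2 V t)) (y ^ q2) \<noteq> 0"
    using y x0 q by (simp add: poly_bloch_poly poly_char_poly_bloch_matrix_gauge)
  thus False using zero x by simp
qed

text \<open>A double root in z2 is pulled back to \<open>y\<close>, where the chain rule turns it
  into a zero of the hopping determinant with zero y-derivative. The threshold is a
  \<open>q1\<close>-th power because z1 = x^q1.\<close>

lemma bloch_poly_no_double_root:
  assumes q: "q1 > 0" "q2 > 0" "coprime q1 q2"
  obtains r where "\<And>a b. norm a \<ge> r \<Longrightarrow> b \<noteq> 0 \<Longrightarrow>
    \<not> (poly (poly_at a (bloch_poly q1 q2 V t)) b = 0 \<and> poly (pderiv (poly_at a (bloch_poly q1 q2 V t))) b = 0)"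
proof -
  let ?n = "q1 * q2" and ?w = "\<lambda>i. t - of_real (V (cell_site q1 i))" and ?f = "bloch_poly q1 q2 V t"
  have n0: "?n > 0" using q by simp
  let ?H = "hop_mat ?n ?w (nbr q1 q2 1 0) (nbr q1 q2 (-1) 0) (nbr q1 q2 0 1) (nbr q1 q2 0 (-1))"
  \<comment> \<open>Exchanging the second pair of shifts replaces \<open>y\<close> by its inverse,
    so large \<open>y\<close> in \<open>?H'\<close> covers |z2| < 1.\<close>
  let ?H' = "hop_mat ?n ?w (nbr q1 q2 1 0) (nbr q1 q2 (-1) 0) (nbr q1 q2 0 (-1)) (nbr q1 q2 0 1)"
  have swap: "?H' x y = ?H x (inverse y)" for x y
    unfolding hop_mat_def by (rule eq_matI) auto
  obtain e where e: "bij_betw e {0..<?n} {0..<?n}"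
    "\<And>u. u < ?n \<Longrightarrow> nbr q1 q2 1 0 (e u) = nbr q1 q2 0 1 (e (Suc u mod ?n))"
    using diagonal_enumeration[OF q, of 1] by auto
  obtain e' where e': "bij_betw e' {0..<?n} {0..<?n}"
    "\<And>u. u < ?n \<Longrightarrow> nbr q1 q2 1 0 (e' u) = nbr q1 q2 0 (-1) (e' (Suc u mod ?n))"
    using diagonal_enumeration[OF q, of "-1"] by auto
  obtain K where K: "K \<ge> 1" "\<And>x y. norm x \<ge> K \<Longrightarrow> norm y \<ge> 1 \<Longrightarrow> det (?H x y) = 0 \<Longrightarrow>
      \<not> ((\<lambda>y. det (?H x y)) has_field_derivative 0) (at y)"
    using hop_mat_no_double_root[OF n0 bij_betw_nbr[OF q(1,2)] e] by blast
  obtain K' where K': "K' \<ge> 1" "\<And>x y. norm x \<ge> K' \<Longrightarrow> norm y \<ge> 1 \<Longrightarrow> det (?H' x y) = 0 \<Longrightarrow>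
      \<not> ((\<lambda>y. det (?H' x y)) has_field_derivative 0) (at y)"
    using hop_mat_no_double_root[OF n0 bij_betw_nbr[OF q(1,2)] e'] by blast
  show ?thesis
  proof (rule that[of "max K K' ^ q1"], rule notI)
    fix a b assume a: "norm a \<ge> max K K' ^ q1" and b: "b \<noteq> 0"
      and dbl: "poly (poly_at a ?f) b = 0 \<and> poly (pderiv (poly_at a ?f)) b = 0"
    obtain x where x: "x ^ q1 = a" using nth_root_exists[OF q(1)] by blast
    have nx: "norm x \<ge> max K K'" using norm_root_ge[of "max K K'" q1 x] a x K(1) q by simp
    hence x0: "x \<noteq> 0" using K(1) by auto
    define A where "A = (\<Sum>i = 0..<?n. lower_bd (fst (cell_site q1 i)))"
    define B where "B = (\<Sum>i = 0..<?n. lower_bd (snd (cell_site q1 i)))"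
    have a0: "a \<noteq> 0" using x x0 q by auto
    have det: "det (?H x y) = poly (poly_at a ?f) (y ^ q2) / (a ^ A * (y ^ q2) ^ B)" if "y \<noteq> 0" for y
      using that x0 q a0 unfolding A_def B_def
      by (simp add: x[symmetric] poly_bloch_poly poly_char_poly_bloch_matrix_gauge)
    \<comment> \<open>The map \<phi> is the identity if |b| \<ge> 1 and inversion otherwise. The
      monomial in the denominator is nonzero and differentiable, so it does not disturb a double
      zero of the numerator.\<close>
    have main: "det (?H x (\<phi> y)) = 0 \<and> ((\<lambda>y. det (?H x (\<phi> y))) has_field_derivative 0) (at y)"
      if \<phi>: "\<And>y. y \<noteq> 0 \<Longrightarrow> \<phi> y \<noteq> 0" and d\<phi>: "\<And>y. y \<noteq> 0 \<Longrightarrow> (\<phi> has_field_derivative \<phi>' y) (at y)"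
        and y: "y \<noteq> 0" "\<phi> y ^ q2 = b" for \<phi> \<phi>' y
    proof
      show "det (?H x (\<phi> y)) = 0" using det[OF \<phi>[OF y(1)]] y(2) dbl by simp
      let ?g = "\<lambda>y. poly (poly_at a ?f) (\<phi> y ^ q2) / (a ^ A * (\<phi> y ^ q2) ^ B)"
      have d1: "((\<lambda>y. \<phi> y ^ q2) has_field_derivative of_nat q2 * (\<phi>' y * \<phi> y ^ (q2 - 1))) (at y)"
        by (auto intro!: derivative_eq_intros d\<phi>[OF y(1)])
      have num: "((\<lambda>y. poly (poly_at a ?f) (\<phi> y ^ q2)) has_field_derivative 0) (at y)"
        using DERIV_chain2[OF poly_DERIV[of "poly_at a ?f" "\<phi> y ^ q2"] d1] y(2) dbl by simp
      have den: "((\<lambda>y. a ^ A * (\<phi> y ^ q2) ^ B) has_field_derivative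
          a ^ A * (of_nat B * (of_nat q2 * (\<phi>' y * \<phi> y ^ (q2 - 1)) * (\<phi> y ^ q2) ^ (B - 1)))) (at y)"
        by (intro DERIV_cmult DERIV_power[OF d1, unfolded One_nat_def[symmetric]])
      have "(?g has_field_derivative 0) (at y)"
        using DERIV_divide[OF num den] \<phi>[OF y(1)] a0 y(2) dbl b by simp
      thus "((\<lambda>y. det (?H x (\<phi> y))) has_field_derivative 0) (at y)"
      proof (rule has_field_derivative_transform_within_open[of _ _ _ "- {0}"])
        show "y \<in> - {0}" using y(1) by simp
        show "?g u = det (?H x (\<phi> u))" if "u \<in> - {0}" for u using det[OF \<phi>, of u] that by simp
      qed auto
    qed
    show False
    proof (cases "norm b \<ge> 1")
      case True
      obtain y where y: "y ^ q2 = b" using nth_root_exists[OF q(2)] by blast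
      have ny: "norm y \<ge> 1" using norm_root_ge[of 1 q2 y] True y q by simp
      have "det (?H x y) = 0 \<and> ((\<lambda>y. det (?H x y)) has_field_derivative 0) (at y)"
        by (rule main[of "\<lambda>y. y" "\<lambda>y. 1"]) (use y ny in auto)
      thus False using K(2)[of x y] nx ny by auto
    next
      case False
      obtain y where y: "y ^ q2 = inverse b" using nth_root_exists[OF q(2)] by blast
      have "norm (inverse b) \<ge> 1" using False b by (simp add: norm_inverse one_le_inverse_iff)
      hence ny: "norm y \<ge> 1" using norm_root_ge[of 1 q2 y] y q by simp
      have y0: "y \<noteq> 0" using ny by auto
      have "det (?H x (inverse y)) = 0 \<and> ((\<lambda>y. det (?H x (inverse y))) has_field_derivative 0) (at y)"
      proof (rule main[of inverse "\<lambda>y. - (inverse y ^ 2)"])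
        show "(inverse has_field_derivative - (inverse u ^ 2)) (at u)" if "u \<noteq> 0" for u :: complex
          using DERIV_inverse[OF that] by (simp add: numeral_2_eq_2)
        show "inverse y ^ q2 = b" using y by (simp add: power_inverse)
      qed (use y0 in auto)
      thus False using K'(2)[of x y] nx ny by (auto simp: swap)
    qed
  qed
qed

section \<open>Extrema of band functions\<close>

lemma norm_cis_diff_le: "norm (cis x - cis y) \<le> 2 * \<bar>x - y\<bar>"
proof -
  have half: "\<bar>sin ((x - y) / 2)\<bar> \<le> \<bar>x - y\<bar> / 2"
    using abs_sin_x_le_abs_x[of "(x - y) / 2"] by simp
  have bd: "\<bar>sin u * v\<bar> \<le> \<bar>x - y\<bar> / 2" if "\<bar>sin u\<bar> \<le> \<bar>x - y\<bar> / 2" "\<bar>v\<bar> \<le> 1" for u v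
  proof -
    have "\<bar>sin u * v\<bar> \<le> \<bar>x - y\<bar> / 2 * 1" unfolding abs_mult using that by (intro mult_mono) auto
    thus ?thesis by simp
  qed
  have "sin x - sin y = 2 * (sin ((x - y) / 2) * cos ((x + y) / 2))" by (simp add: sin_diff_sin)
  hence s: "\<bar>sin x - sin y\<bar> \<le> \<bar>x - y\<bar>" using bd[OF half, of "cos ((x + y) / 2)"] by simp
  have half': "\<bar>sin ((y - x) / 2)\<bar> \<le> \<bar>x - y\<bar> / 2"
    using abs_sin_x_le_abs_x[of "(y - x) / 2"] by simp
  have "cos x - cos y = 2 * (sin ((y - x) / 2) * sin ((x + y) / 2))" by (simp add: cos_diff_cos)
  hence c: "\<bar>cos x - cos y\<bar> \<le> \<bar>x - y\<bar>" using bd[OF half', of "sin ((x + y) / 2)"] by simp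
  have "norm (cis x - cis y) \<le> \<bar>Re (cis x - cis y)\<bar> + \<bar>Im (cis x - cis y)\<bar>" by (rule cmod_le)
  thus ?thesis using s c by simp
qed

lemma hop_entry_lipschitz:
  assumes q: "q1 > 0" and i: "i < q1 * q2" and b: "\<bar>b\<bar> \<le> 1" and z1: "norm z1 = 1"
  shows "norm (hop_entry q1 q2 z1 (cis (2 * pi * s)) a b i j - hop_entry q1 q2 z1 (cis (2 * pi * t)) a b i j)
    \<le> 4 * pi * \<bar>s - t\<bar>"
proof -
  let ?c = "(snd (cell_site q1 i) + b) div int q2"
  note bd = cell_site_bounds[OF q i]
  have "\<bar>?c\<bar> \<le> 1" using neighbour_div_bounds[OF bd(3,4) b] by (auto simp: of_bool_def split: if_splits)
  hence "real_of_int \<bar>?c\<bar> \<le> 1" by linarith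
  hence c: "\<bar>real_of_int ?c\<bar> \<le> 1" by simp
  have "norm (cis (2 * pi * s) powi ?c - cis (2 * pi * t) powi ?c) \<le> 2 * \<bar>of_int ?c * (2 * pi * s) - of_int ?c * (2 * pi * t)\<bar>"
    unfolding cis_power_int by (rule norm_cis_diff_le)
  also have "of_int ?c * (2 * pi * s) - of_int ?c * (2 * pi * t) = of_int ?c * (2 * pi * (s - t))"
    by (simp add: algebra_simps)
  also have "2 * \<bar>of_int ?c * (2 * pi * (s - t))\<bar> = \<bar>real_of_int ?c\<bar> * (4 * pi * \<bar>s - t\<bar>)"
    by (simp add: abs_mult)
  also have "\<dots> \<le> 1 * (4 * pi * \<bar>s - t\<bar>)" using c by (intro mult_right_mono) auto
  finally have le: "norm (cis (2 * pi * s) powi ?c - cis (2 * pi * t) powi ?c) \<le> 4 * pi * \<bar>s - t\<bar>" by simp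
  show ?thesis
  proof (cases "site_index q1 q2 (fst (cell_site q1 i) + a) (snd (cell_site q1 i) + b) = j")
    case True
    have "norm (hop_entry q1 q2 z1 (cis (2 * pi * s)) a b i j - hop_entry q1 q2 z1 (cis (2 * pi * t)) a b i j) =
      norm (cis (2 * pi * s) powi ?c - cis (2 * pi * t) powi ?c)"
      using True z1 by (simp add: hop_entry_def Let_def norm_mult norm_power_int flip: right_diff_distrib)
    thus ?thesis using le by simp
  qed (simp add: hop_entry_def Let_def)
qed

text \<open>Four hops with Lipschitz constant \<open>4 * pi\<close> each give \<open>16 * pi\<close>
  per entry, and the perturbation bound contributes the size of the matrix. The value of the
  constant is irrelevant to the final count.\<close>

lemma bloch_eigenvalue_lipschitz:
  assumes q: "q1 > 0" "q2 > 0" and z1: "norm z1 = 1" and m: "m < q1 * q2"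
  shows "\<bar>eigenvalues_sorted (bloch_matrix q1 q2 V z1 (cis (2 * pi * s))) ! m
    - eigenvalues_sorted (bloch_matrix q1 q2 V z1 (cis (2 * pi * t))) ! m\<bar>
    \<le> real (q1 * q2) * (16 * pi) * \<bar>s - t\<bar>"
proof -
  have entry: "norm (bloch_matrix q1 q2 V z1 (cis (2 * pi * s)) $$ (i, j) - bloch_matrix q1 q2 V z1 (cis (2 * pi * t)) $$ (i, j))
    \<le> 16 * pi * \<bar>s - t\<bar>" if ij: "i < q1 * q2" "j < q1 * q2" for i j s t
  proof -
    define d where "d a b = hop_entry q1 q2 z1 (cis (2 * pi * s)) a b i j - hop_entry q1 q2 z1 (cis (2 * pi * t)) a b i j" for a b
    have d: "norm (d a b) \<le> 4 * pi * \<bar>s - t\<bar>" if "\<bar>b\<bar> \<le> 1" for a b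
      unfolding d_def by (rule hop_entry_lipschitz[OF q(1) ij(1) that z1])
    have "bloch_matrix q1 q2 V z1 (cis (2 * pi * s)) $$ (i, j) - bloch_matrix q1 q2 V z1 (cis (2 * pi * t)) $$ (i, j)
      = - (d 1 0 + d (-1) 0 + d 0 1 + d 0 (-1))"
      using ij by (simp add: bloch_matrix_def d_def)
    also have "norm \<dots> = norm (d 1 0 + d (-1) 0 + d 0 1 + d 0 (-1))" by (rule norm_minus_cancel)
    also have "\<dots> \<le> norm (d 1 0) + norm (d (-1) 0) + norm (d 0 1) + norm (d 0 (-1))"
      by (intro order.trans[OF norm_triangle_ineq] add_mono order.refl)
    also have "\<dots> \<le> 4 * pi * \<bar>s - t\<bar> + 4 * pi * \<bar>s - t\<bar> + 4 * pi * \<bar>s - t\<bar> + 4 * pi * \<bar>s - t\<bar>"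
      by (intro add_mono d) auto
    finally show ?thesis by simp
  qed
  let ?E = "\<lambda>s. eigenvalues_sorted (bloch_matrix q1 q2 V z1 (cis (2 * pi * s))) ! m"
  have le: "?E t \<le> ?E s + real (q1 * q2) * (16 * pi * \<bar>s - t\<bar>)" for s t
    by (rule eigenvalues_sorted_perturbation[OF bloch_matrix_carrier bloch_matrix_hermitian
        bloch_matrix_carrier bloch_matrix_hermitian entry m]) (use q z1 in auto)
  show ?thesis using le[of s t] le[of t s] by (simp add: abs_le_iff abs_minus_commute algebra_simps)
qed

text \<open>Either the extremal factor is multiplied by a factor of constant sign, and the product has a local
  extremum, or that factor vanishes too, and the product is \<open>o(t - s)\<close>.\<close>

lemma product_at_extremum_has_derivative_zero:
  fixes E :: "real \<Rightarrow> nat \<Rightarrow> real"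
  assumes lip: "\<And>t j. j < n \<Longrightarrow> \<bar>E t j - E s j\<bar> \<le> C * \<bar>t - s\<bar>"
    and m: "m < n" "E s m = c" and ext: "(\<forall>t. E t m \<le> c) \<or> (\<forall>t. c \<le> E t m)"
    and D: "((\<lambda>t. \<Prod>j = 0..<n. c - E t j) has_real_derivative D) (at s)"
  shows "D = 0"
proof -
  define P where "P t = (\<Prod>j = 0..<n. c - E t j)" for t
  define R where "R t = (\<Prod>j\<in>{0..<n} - {m}. c - E t j)" for t
  have P: "P t = (c - E t m) * R t" for t
    unfolding P_def R_def using m(1) by (subst prod.remove[of _ m]) auto
  have Ps: "P s = 0" using P[of s] m(2) by simp
  have D: "(P has_real_derivative D) (at s)" using D by (simp add: P_def[abs_def])
  have "isCont (\<lambda>t. E t j) s" if "j < n" for j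
  proof -
    have "((\<lambda>t. E t j - E s j) \<longlongrightarrow> 0) (at s)"
    proof (rule tendsto_0_le[where K = 1])
      show "\<forall>\<^sub>F t in at s. norm (E t j - E s j) \<le> norm (C * \<bar>t - s\<bar>) * 1"
        using order.trans[OF lip[OF that] abs_ge_self] by (intro always_eventually allI) simp
      have "((\<lambda>t. C * \<bar>t - s\<bar>) \<longlongrightarrow> C * \<bar>s - s\<bar>) (at s)" by (intro tendsto_intros)
      thus "((\<lambda>t. C * \<bar>t - s\<bar>) \<longlongrightarrow> 0) (at s)" by simp
    qed
    thus ?thesis unfolding isCont_def by (simp add: LIM_zero_iff)
  qed
  hence R: "isCont R s" unfolding R_def[abs_def] by (intro continuous_intros) auto
  show ?thesis
  proof (cases "R s = 0")
    case True
    have q: "((\<lambda>t. (P t - P s) / (t - s)) \<longlongrightarrow> D) (at s)"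
      using D by (simp add: has_field_derivative_iff)
    have "((\<lambda>t. (P t - P s) / (t - s)) \<longlongrightarrow> 0) (at s)"
    proof (rule tendsto_0_le[where K = 1])
      show "\<forall>\<^sub>F t in at s. norm ((P t - P s) / (t - s)) \<le> norm (C * \<bar>R t\<bar>) * 1"
        unfolding eventually_at_filter
      proof (intro always_eventually allI impI)
        fix t assume "t \<noteq> s"
        have "\<bar>P t\<bar> \<le> C * \<bar>t - s\<bar> * \<bar>R t\<bar>"
          unfolding P abs_mult using lip[OF m(1), of t] m(2) by (intro mult_right_mono) auto
        hence "norm ((P t - P s) / (t - s)) \<le> C * \<bar>R t\<bar>"
          using \<open>t \<noteq> s\<close> by (simp add: Ps abs_divide field_simps)
        thus "norm ((P t - P s) / (t - s)) \<le> norm (C * \<bar>R t\<bar>) * 1" by simp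
      qed
      have "((\<lambda>t. C * \<bar>R t\<bar>) \<longlongrightarrow> C * \<bar>R s\<bar>) (at s)"
        using R unfolding isCont_def by (intro tendsto_intros)
      thus "((\<lambda>t. C * \<bar>R t\<bar>) \<longlongrightarrow> 0) (at s)" using True by simp
    qed
    thus ?thesis using tendsto_unique[OF _ q] by simp
  next
    case False
    \<comment> \<open>Near \<open>s\<close> the cofactor keeps the sign of \<open>R s\<close>. This
      sign, together with the kind of extremum of the band, decides whether the product has a local
      maximum or minimum.\<close>
    have "\<exists>d>0. \<forall>t. \<bar>s - t\<bar> < d \<longrightarrow> R t * R s > 0"
    proof -
      have "isCont (\<lambda>t. R t * R s) s" using R by (intro continuous_intros)
      hence "((\<lambda>t. R t * R s) \<longlongrightarrow> R s * R s) (at s)" by (simp add: isCont_def)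
      moreover have "R s * R s > 0" using False by (simp add: zero_less_mult_iff) linarith
      ultimately have "\<forall>\<^sub>F t in at s. R t * R s > 0" by (rule order_tendstoD)
      then obtain d where "d > 0" "\<And>t. t \<noteq> s \<Longrightarrow> dist t s < d \<Longrightarrow> R t * R s > 0"
        unfolding eventually_at by auto
      thus ?thesis using \<open>R s * R s > 0\<close>
        by (intro exI[of _ d]) (metis abs_minus_commute dist_real_def)
    qed
    then obtain d where d: "d > 0" "\<And>t. \<bar>s - t\<bar> < d \<Longrightarrow> R t * R s > 0" by blast
    have "(\<forall>t. \<bar>s - t\<bar> < d \<longrightarrow> P t \<le> P s) \<or> (\<forall>t. \<bar>s - t\<bar> < d \<longrightarrow> P s \<le> P t)"
      using ext
    proof
      assume le: "\<forall>t. E t m \<le> c"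
      show ?thesis
        using d(2) le False unfolding Ps unfolding P
        by (cases "R s > 0") (auto simp: zero_less_mult_iff mult_le_0_iff zero_le_mult_iff dest: less_imp_le)
    next
      assume ge: "\<forall>t. c \<le> E t m"
      show ?thesis
        using d(2) ge False unfolding Ps unfolding P
        by (cases "R s > 0") (auto simp: zero_less_mult_iff mult_le_0_iff zero_le_mult_iff dest: less_imp_le)
    qed
    thus ?thesis using DERIV_local_max[OF D d(1)] DERIV_local_min[OF D d(1)] by blast
  qed
qed

text \<open>Carries a complex derivative over to the real product of the spectral distances: a
  function that is real on the real axis has a real derivative there, so the vanishing of its real
  part suffices.\<close>

lemma has_field_derivative_real_valued:
  assumes G: "(G has_field_derivative D) (at (complex_of_real s))"
    and real: "\<And>t. G (complex_of_real t) = complex_of_real (P t)"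
  shows "(P has_real_derivative Re D) (at s)" "Im D = 0"
proof -
  have "((\<lambda>t. complex_of_real t) has_derivative (\<lambda>h. complex_of_real h)) (at s)"
    by (intro has_derivative_of_real has_derivative_ident)
  from has_derivative_compose[OF this, of G] G
  have c: "((\<lambda>t. G (complex_of_real t)) has_derivative (\<lambda>h. D * complex_of_real h)) (at s)"
    unfolding has_field_derivative_def by blast
  from bounded_linear.has_derivative[OF bounded_linear_Re c]
  have "(P has_derivative (\<lambda>h. Re D * h)) (at s)" by (simp add: real)
  thus "(P has_real_derivative Re D) (at s)" by (simp add: has_field_derivative_def)
  from bounded_linear.has_derivative[OF bounded_linear_Im c]
  have "((\<lambda>t :: real. 0 :: real) has_derivative (\<lambda>h. Im D * h)) (at s)" by (simp add: real)
  hence "((\<lambda>t :: real. 0 :: real) has_real_derivative Im D) (at s)" by (simp add: has_field_derivative_def)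
  thus "Im D = 0" by (rule DERIV_unique) simp
qed

text \<open>Dividing the polynomial by its nonvanishing monomial gives the real product over all
  bands, whose derivative vanishes at the extremum. The derivative of the exponential
  parametrisation is nowhere zero, so the polynomial derivative vanishes as well.\<close>

lemma extremum_is_double_root:
  fixes V :: "int \<times> int \<Rightarrow> real" and lam :: real
  assumes q: "q1 > 0" "q2 > 0" and m: "m < q1 * q2" and z1: "norm z1 = 1"
  defines "E \<equiv> \<lambda>t. eigenvalues_sorted (bloch_matrix q1 q2 V z1 (cis (2 * pi * t)))"
  assumes s: "E s ! m = lam" and ext: "(\<forall>t. E t ! m \<le> lam) \<or> (\<forall>t. lam \<le> E t ! m)"
  defines "p \<equiv> poly_at z1 (bloch_poly q1 q2 V (of_real lam))"
  shows "poly p (cis (2 * pi * s)) = 0 \<and> poly (pderiv p) (cis (2 * pi * s)) = 0"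
proof -
  let ?n = "q1 * q2"
  define A where "A = (\<Sum>i = 0..<?n. lower_bd (fst (cell_site q1 i)))"
  define B where "B = (\<Sum>i = 0..<?n. lower_bd (snd (cell_site q1 i)))"
  define P where "P t = (\<Prod>j = 0..<?n. lam - E t ! j)" for t
  have z0: "z1 \<noteq> 0" using z1 by auto
  have eq: "poly p (cis (2 * pi * t)) = z1 ^ A * cis (2 * pi * t) ^ B * of_real (P t)" for t
    unfolding p_def A_def B_def P_def E_def
    by (subst poly_bloch_poly[OF q(1) z0], simp,
        subst char_poly_hermitian[OF bloch_matrix_carrier bloch_matrix_hermitian[OF q z1]]) auto
  \<comment> \<open>The parametrisation of the circle is extended to complex arguments, so that
    complex differentiation of polynomials and the chain rule apply.\<close>
  define e where "e \<zeta> = exp (\<i> * (2 * pi * \<zeta>))" for \<zeta> :: complex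
  have e: "e (of_real t) = cis (2 * pi * t)" for t by (simp add: e_def cis_conv_exp)
  have e0: "e \<zeta> \<noteq> 0" for \<zeta> by (simp add: e_def)
  have de: "(e has_field_derivative (\<i> * (2 * pi)) * e \<zeta>) (at \<zeta>)" for \<zeta>
    unfolding e_def[abs_def] by (auto intro!: derivative_eq_intros)
  define G where "G \<zeta> = poly p (e \<zeta>) / (z1 ^ A * e \<zeta> ^ B)" for \<zeta>
  have real: "G (complex_of_real t) = complex_of_real (P t)" for t
    using eq[of t] z0 e0[of "of_real t"] by (simp add: G_def e)
  have "P s = 0" unfolding P_def using s m by (intro prod_zero) auto
  hence root: "poly p (cis (2 * pi * s)) = 0" using eq[of s] by simp
  let ?s = "complex_of_real s"
  have num: "((\<lambda>\<zeta>. poly p (e \<zeta>)) has_field_derivative poly (pderiv p) (e ?s) * ((\<i> * (2 * pi)) * e ?s)) (at ?s)"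
    by (rule DERIV_chain2[OF poly_DERIV de])
  obtain U' where den: "((\<lambda>\<zeta>. z1 ^ A * e \<zeta> ^ B) has_field_derivative U') (at ?s)"
    using DERIV_cmult[OF DERIV_power[OF de]] by blast
  have den0: "z1 ^ A * e ?s ^ B \<noteq> 0" using z0 e0 by simp
  define D where "D = poly (pderiv p) (e ?s) * ((\<i> * (2 * pi)) * e ?s) / (z1 ^ A * e ?s ^ B)"
  have "(G has_field_derivative D) (at ?s)"
  proof -
    have "poly p (e ?s) = 0" using root by (simp add: e)
    hence "(poly (pderiv p) (e ?s) * ((\<i> * (2 * pi)) * e ?s) * (z1 ^ A * e ?s ^ B) - poly p (e ?s) * U') /
        ((z1 ^ A * e ?s ^ B) * (z1 ^ A * e ?s ^ B)) = D"
      unfolding D_def using den0 by simp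
    with DERIV_divide[OF num den den0] show ?thesis unfolding G_def[abs_def] by (simp only:)
  qed
  note GD = has_field_derivative_real_valued[OF this real]
  have "Re D = 0"
  proof (rule product_at_extremum_has_derivative_zero[where E = "\<lambda>t j. E t ! j" and c = lam and s = s and m = m and n = ?n])
    show "\<bar>E t ! j - E s ! j\<bar> \<le> real ?n * (16 * pi) * \<bar>t - s\<bar>" if "j < ?n" for t j
      unfolding E_def by (rule bloch_eigenvalue_lipschitz[OF q z1 that])
    show "((\<lambda>t. \<Prod>j = 0..<?n. lam - E t ! j) has_real_derivative Re D) (at s)"
      using GD(1) by (simp add: P_def[abs_def])
  qed (use m s ext in auto)
  hence "D = 0" using GD(2) by (simp add: complex_eq_iff)
  hence "poly (pderiv p) (e ?s) = 0" using z0 e0[of ?s] unfolding D_def by simp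
  thus ?thesis using root by (simp add: e)
qed

text \<open>Lets any real k2 be reduced to the half-open interval, so that extremality over the
  Brillouin zone holds along the whole real line, also around the end point 0.\<close>

lemma cis_2pi_frac: "cis (2 * pi * frac t) = cis (2 * pi * t)"
proof -
  have "cis (2 * pi * t) = cis (2 * pi * frac t) * cis (2 * pi * of_int \<lfloor>t\<rfloor>)"
    by (simp add: cis_mult frac_def algebra_simps)
  also have "cis (2 * pi * of_int \<lfloor>t\<rfloor>) = 1" by (rule cis_multiple_2pi) simp
  finally show ?thesis by simp
qed

lemma cis_2pi_inj:
  assumes "cis (2 * pi * s) = cis (2 * pi * t)" "0 \<le> s" "s < 1" "0 \<le> t" "t < 1"
  shows "s = t"
proof -
  have "sin (2 * pi * s) = sin (2 * pi * t) \<and> cos (2 * pi * s) = cos (2 * pi * t)"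
    using assms(1) by (simp add: complex_eq_iff)
  then obtain n :: int where "2 * pi * s = 2 * pi * t + 2 * pi * of_int n"
    unfolding sin_cos_eq_iff by auto
  hence "2 * pi * s = 2 * pi * (t + of_int n)" by (simp add: distrib_left)
  hence n: "s = t + of_int n" by simp
  hence "-1 < real_of_int n" "real_of_int n < 1" using assms by linarith+
  hence "n = 0" by linarith
  thus ?thesis using n by simp
qed

theorem mainTheorem10:
  fixes q1 q2 m :: nat and V :: "int \<times> int \<Rightarrow> real" and lam :: real
  assumes "q1 > 0" and "q2 > 0" and "coprime q1 q2"
    and "\<And>n. V (fst n + int q1, snd n) = V n"
    and "\<And>n. V (fst n, snd n + int q2) = V n"
    and "1 \<le> m" and "m \<le> q1 * q2"
    and "(\<exists>k0\<in>brillouin_zone. band_function q1 q2 V m k0 = lam) \<and>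
         ((\<forall>k\<in>brillouin_zone. band_function q1 q2 V m k \<le> lam) \<or>
          (\<forall>k\<in>brillouin_zone. lam \<le> band_function q1 q2 V m k))"
  shows "finite {k \<in> brillouin_zone. band_function q1 q2 V m k = lam} \<and>
         card {k \<in> brillouin_zone. band_function q1 q2 V m k = lam} \<le> 4 * (q1 + q2)^2"
proof -
  note q = assms(1-3)
  let ?S = "{k \<in> brillouin_zone. band_function q1 q2 V m k = lam}"
  let ?f = "bloch_poly q1 q2 V (of_real lam)"
  define Z where "Z = {(a, b). a \<in> {a. norm a = 1} \<and> b \<noteq> 0 \<and> poly (poly_at a ?f) b = 0 \<and>
    poly (pderiv (poly_at a ?f)) b = 0}"
  obtain r where r: "\<And>a b. norm a \<ge> r \<Longrightarrow> b \<noteq> 0 \<Longrightarrow>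
      \<not> (poly (poly_at a ?f) b = 0 \<and> poly (pderiv (poly_at a ?f)) b = 0)"
    using bloch_poly_no_double_root[OF q] by blast
  \<comment> \<open>The factor \<open>2 * q2\<close> bounds the degree in z1 of the coefficients;
    \<open>2 * (2 * q1)\<close> bounds the sum of the z2-degrees of the polynomial and its
    derivative.\<close>
  have Z: "finite Z \<and> card Z \<le> 2 * q2 * (2 * (2 * q1))"
    unfolding Z_def
    by (rule card_double_roots_le[OF bloch_poly_degrees[OF q(1)] r]) (use bloch_poly_at_nonzero[OF q] in auto)
  define \<zeta> where "\<zeta> k = (cis (2 * pi * fst k), cis (2 * pi * snd k))" for k :: "real \<times> real"
  have inj: "inj_on \<zeta> ?S"
    by (rule inj_onI) (auto simp: \<zeta>_def brillouin_zone_def prod_eq_iff dest: cis_2pi_inj)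
  have sub: "\<zeta> ` ?S \<subseteq> Z"
  proof (rule image_subsetI)
    fix k assume k: "k \<in> ?S"
    let ?E = "\<lambda>t. eigenvalues_sorted (bloch_matrix q1 q2 V (cis (2 * pi * fst k)) (cis (2 * pi * t)))"
    \<comment> \<open>Bands are numbered from 1, list positions from 0.\<close>
    have band: "?E t ! (m - 1) = band_function q1 q2 V m (fst k, frac t)" for t
      by (simp add: band_function_def floquet_matrix_eq_bloch_matrix cis_2pi_frac)
    have bz: "(fst k, frac t) \<in> brillouin_zone" for t
      using k by (simp add: brillouin_zone_def frac_lt_1)
    have "poly (poly_at (cis (2 * pi * fst k)) ?f) (cis (2 * pi * snd k)) = 0 \<and>
      poly (pderiv (poly_at (cis (2 * pi * fst k)) ?f)) (cis (2 * pi * snd k)) = 0"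
    proof (rule extremum_is_double_root[OF q(1,2)])
      show "m - 1 < q1 * q2" using assms(6,7) by linarith
      show "?E (snd k) ! (m - 1) = lam"
        using k by (simp add: band_function_def floquet_matrix_eq_bloch_matrix)
      show "(\<forall>t. ?E t ! (m - 1) \<le> lam) \<or> (\<forall>t. lam \<le> ?E t ! (m - 1))"
        unfolding band using assms(8) bz by blast
    qed simp
    thus "\<zeta> k \<in> Z" by (simp add: Z_def \<zeta>_def)
  qed
  have "card ?S = card (\<zeta> ` ?S)" using card_image[OF inj] by simp
  also have "\<dots> \<le> card Z" using Z sub by (intro card_mono) auto
  also have "\<dots> \<le> 8 * (q1 * q2)" using Z by (simp add: mult.commute)
  \<comment> \<open>The mixed term of the expanded square is already
    \<open>8 * (q1 * q2)\<close>.\<close>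
  also have "\<dots> \<le> 4 * (q1 + q2)^2" by (simp add: power2_eq_square algebra_simps)
  finally have "card ?S \<le> 4 * (q1 + q2)^2" .
  moreover have "finite ?S"
    using finite_imageD[OF finite_subset[OF sub] inj] Z by blast
  ultimately show ?thesis by blast
qed

end
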